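(* Let $G$ be a locally compact group and $H$ a closed subgroup with $\Delta_G(h)=\Delta_H(h)$ for all $h\in H$, such that the homogeneous space $G/H$ is $\sigma$-compact. Let $\pi$ be an irreducible square integrable representation of $G/H$ on a Hilbert space $\mathcal{H}_\pi$. Then every admissible pair $(\xi_1,\xi_2)$ in $\mathcal{H}_\pi$ possesses the homogeneous approximation property in $\mathcal{H}_\pi$.
   Context: $\Delta_G,\Delta_H$ are the modular functions of $G$ and $H$. $G/H$ is the left coset space with the quotient topology and $G$ acts by $(g,aH)\mapsto gaH$. A rho function is a continuous $\rho:G\to(0,\infty)$ with $\rho(gh)=\rho(g)$ for all $g\in G,h\in H$. Throughout, $\mu_{G/H}$ is a relatively $G$-invariant Radon measure on $G/H$ arising from a rho function $\rho$; thus $d\mu_{G/H}(saH)=\frac{\rho(s)}{\rho(e)}\,d\mu_{G/H}(aH)$ and $\rho(sa)\rho(e)=\rho(s)\rho(a)$ for $s,a\in G$, so that $\frac{\rho(e)}{\rho(a)}d\mu_{G/H}(aH)$ is $G$-invariant. A continuous unitary representation of $G/H$ on $\mathcal{H}_\pi$ is a map $\pi$ from $G/H$ into the unitary operators on $\mathcal{H}_\pi$ such that $gH\mapsto\langle\pi(gH)\xi,\eta\rangle$ is continuous for all $\xi,\eta\in\mathcal{H}_\pi$, and $\pi(gkH)=\pi(gH)\pi(kH)$, $\pi(g^{-1}H)=\pi(gH)^*$ for all $g,k\in G$. Inner products are linear in the first variable. A vector $\xi\in\mathcal{H}_\pi$ is an admissible wavelet if $0<C_\xi<\infty$, where $C_\xi=\int_{G/H}\frac{\rho(e)}{\rho(g)}|\langle\xi,\pi(gH)\xi\rangle|^2d\mu_{G/H}(gH)$;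 $\pi$ is square integrable if an admissible wavelet exists. The wavelet transform is $(W_\xi\eta)(gH)=\left(\frac{\rho(e)}{\rho(g)}\right)^{1/2}\langle\eta,\pi(gH)\xi\rangle$ for $\eta\in\mathcal{H}_\pi$. A pair $(\xi_1,\xi_2)$ of admissible wavelets is an admissible pair if $\langle\xi_1,\xi_2\rangle\neq0$ and $$C_{\xi_1\xi_2}=\frac{1}{\langle\xi_1,\xi_2\rangle}\int_{G/H}W_{\xi_1}(\xi_1)(gH)\,\overline{W_{\xi_2}(\xi_2)(gH)}\,d\mu_{G/H}(gH)$$ is a non-zero scalar. An admissible pair $(\xi_1,\xi_2)$ has the homogeneous approximation property in $\mathcal{H}_\pi$ if for every $\eta\in\mathcal{H}_\pi$ and $\epsilon>0$ there is a compact $K\subseteq G/H$ such that every compact $K'\subseteq G/H$ with $K\subseteq K'$ satisfies, for all $s\in G$, $$\left\|\pi(sH)\eta-C_{\xi_1\xi_2}^{-1}\int_{s\cdot K'}\left(\frac{\rho(e)}{\rho(a)}\right)^{1/2}\big(W_{\xi_1}(\pi(sH)\eta)\big)(aH)\,\pi(aH)\xi_2\,d\mu_{G/H}(aH)\right\|\le\epsilon,$$ where $s\cdot K'=\{saH: aH\in K'\}$ and the integral is taken in the weak sense. *)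

theory Defs
  imports "HOL-Analysis.Analysis" "HOL-Algebra.Left_Coset"
begin

section \<open>Complex Hilbert spaces\<close>

text \<open>
  The inner product is linear in its first argument. Positivity and definiteness of the inner
  product follow from \<open>norm_eq_sqrt_cinner\<close>, and completeness is part of \<^class>\<open>banach\<close>.
\<close>

class complex_hilbert_space = banach +
  fixes scaleC :: "complex \<Rightarrow> 'a \<Rightarrow> 'a" (infixr \<open>*\<^sub>C\<close> 75)
    and cinner :: "'a \<Rightarrow> 'a \<Rightarrow> complex"
  assumes scaleC_add_right: "c *\<^sub>C (x + y) = c *\<^sub>C x + c *\<^sub>C y"
    and scaleC_add_left: "(c + d) *\<^sub>C x = c *\<^sub>C x + d *\<^sub>C x"
    and scaleC_scaleC: "c *\<^sub>C (d *\<^sub>C x) = (c * d) *\<^sub>C x"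
    and scaleR_scaleC: "r *\<^sub>R x = complex_of_real r *\<^sub>C x"
    and cinner_commute: "cinner x y = cnj (cinner y x)"
    and cinner_add_left: "cinner (x + y) z = cinner x z + cinner y z"
    and cinner_scaleC_left: "cinner (c *\<^sub>C x) y = c * cinner x y"
    and norm_eq_sqrt_cinner: "norm x = sqrt (Re (cinner x x))"

instantiation complex :: complex_hilbert_space
begin

definition scaleC_complex :: "complex \<Rightarrow> complex \<Rightarrow> complex"
  where "scaleC_complex c x = c * x"

definition cinner_complex :: "complex \<Rightarrow> complex \<Rightarrow> complex"
  where "cinner_complex x y = x * cnj y"

instance
proof
  fix c d x y z :: complex and r :: real
  show "c *\<^sub>C (x + y) = c *\<^sub>C x + c *\<^sub>C y"
    and "(c + d) *\<^sub>C x = c *\<^sub>C x + d *\<^sub>C x"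
    and "c *\<^sub>C (d *\<^sub>C x) = (c * d) *\<^sub>C x"
    unfolding scaleC_complex_def by (simp_all only: distrib_left distrib_right mult.assoc)
  show "r *\<^sub>R x = complex_of_real r *\<^sub>C x"
    unfolding scaleC_complex_def by (rule scaleR_conv_of_real)
  show "cinner x y = cnj (cinner y x)"
    and "cinner (x + y) z = cinner x z + cinner y z"
    and "cinner (c *\<^sub>C x) y = c * cinner x y"
    unfolding scaleC_complex_def cinner_complex_def by (simp_all add: distrib_right)
  show "norm x = sqrt (Re (cinner x x))"
    unfolding cinner_complex_def by (simp add: norm_complex_def power2_eq_square)
qed

end

definition unitary_operator :: "('h::complex_hilbert_space \<Rightarrow> 'h) \<Rightarrow> bool"
  where "unitary_operator U \<longleftrightarrow>
    (\<forall>x y. U (x + y) = U x + U y) \<and> (\<forall>c x. U (c *\<^sub>C x) = c *\<^sub>C U x) \<and>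
    (\<forall>x y. cinner (U x) (U y) = cinner x y) \<and> surj U"

definition is_adjoint ::
  "('h::complex_hilbert_space \<Rightarrow> 'h) \<Rightarrow> ('h \<Rightarrow> 'h) \<Rightarrow> bool"
  where "is_adjoint A B \<longleftrightarrow> (\<forall>x y. cinner (A x) y = cinner x (B y))"

definition closed_csubspace :: "'h::complex_hilbert_space set \<Rightarrow> bool"
  where "closed_csubspace M \<longleftrightarrow>
    0 \<in> M \<and> (\<forall>x\<in>M. \<forall>y\<in>M. x + y \<in> M) \<and> (\<forall>c. \<forall>x\<in>M. c *\<^sub>C x \<in> M) \<and> closed M"

definition has_weak_integral ::
  "'a measure \<Rightarrow> 'a set \<Rightarrow> ('a \<Rightarrow> 'h::complex_hilbert_space) \<Rightarrow> 'h \<Rightarrow> bool"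
  where "has_weak_integral M A f v \<longleftrightarrow>
    (\<forall>\<zeta>. set_integrable M A (\<lambda>x. cinner (f x) \<zeta>) \<and>
         cinner v \<zeta> = (LINT x:A|M. cinner (f x) \<zeta>))"

section \<open>Radon measures\<close>

definition sigma_compact_space :: "'a topology \<Rightarrow> bool"
  where "sigma_compact_space X \<longleftrightarrow>
    (\<exists>\<K>. countable \<K> \<and> (\<forall>K\<in>\<K>. compactin X K) \<and> \<Union>\<K> = topspace X)"

definition radon_measure :: "'a topology \<Rightarrow> 'a measure \<Rightarrow> bool"
  where "radon_measure X M \<longleftrightarrow>
    space M = topspace X \<and> sets M = sigma_sets (topspace X) {U. openin X U} \<and>
    (\<forall>K. compactin X K \<longrightarrow> emeasure M K < \<infinity>) \<and>
    (\<forall>E\<in>sets M. emeasure M E = (INF U\<in>{U. openin X U \<and> E \<subseteq> U}. emeasure M U)) \<and>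
    (\<forall>U. openin X U \<longrightarrow>
       emeasure M U = (SUP K\<in>{K. compactin X K \<and> K \<subseteq> U}. emeasure M K))"

section \<open>Locally compact groups\<close>

locale locally_compact_group = group G
  for G :: "('g, 'm) monoid_scheme" (structure) and T :: "'g topology" +
  assumes topspace_eq_carrier: "topspace T = carrier G"
    and continuous_mult: "continuous_map (prod_topology T T) T (\<lambda>(x, y). x \<otimes> y)"
    and continuous_inv: "continuous_map T T (\<lambda>x. inv x)"
    and Hausdorff: "Hausdorff_space T"
    and locally_compact: "locally_compact_space T"

definition left_haar_measure ::
  "('g, 'm) monoid_scheme \<Rightarrow> 'g topology \<Rightarrow> 'g measure \<Rightarrow> bool"
  where "left_haar_measure G T m \<longleftrightarrow>
    radon_measure T m \<and> emeasure m (space m) \<noteq> 0 \<and>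
    (\<forall>g\<in>carrier G. \<forall>E\<in>sets m. emeasure m (g <#\<^bsub>G\<^esub> E) = emeasure m E)"

text \<open>
  The convention is $m(Ea) = \Delta(a)\,m(E)$ for a left Haar measure $m$. Existence and uniqueness
  of Haar measure up to a positive factor make the description well defined.
\<close>

definition modular_function ::
  "('g, 'm) monoid_scheme \<Rightarrow> 'g topology \<Rightarrow> 'g \<Rightarrow> real"
  where "modular_function G T a =
    (THE c. 0 < c \<and> (\<forall>m. left_haar_measure G T m \<longrightarrow>
       (\<forall>E\<in>sets m. emeasure m (E #>\<^bsub>G\<^esub> a) = ennreal c * emeasure m E)))"

section \<open>The homogeneous space of left cosets\<close>

definition coset_topology ::
  "('g, 'm) monoid_scheme \<Rightarrow> 'g topology \<Rightarrow> 'g set \<Rightarrow> 'g set topology"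
  where "coset_topology G T H =
    topology (\<lambda>U. U \<subseteq> lcosets\<^bsub>G\<^esub> H \<and> openin T {g \<in> topspace T. g <#\<^bsub>G\<^esub> H \<in> U})"

lemma openin_coset_topology:
  "openin (coset_topology G T H) U \<longleftrightarrow>
    U \<subseteq> lcosets\<^bsub>G\<^esub> H \<and> openin T {g \<in> topspace T. g <#\<^bsub>G\<^esub> H \<in> U}"
proof -
  let ?P = "\<lambda>U. U \<subseteq> lcosets\<^bsub>G\<^esub> H \<and> openin T {g \<in> topspace T. g <#\<^bsub>G\<^esub> H \<in> U}"
  have "istopology ?P"
    unfolding istopology_def
  proof (intro conjI allI impI)
    fix S S' assume S: "?P S" and S': "?P S'"
    show "S \<inter> S' \<subseteq> lcosets\<^bsub>G\<^esub> H" using S by blast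
    have "{g \<in> topspace T. g <#\<^bsub>G\<^esub> H \<in> S \<inter> S'} =
        {g \<in> topspace T. g <#\<^bsub>G\<^esub> H \<in> S} \<inter> {g \<in> topspace T. g <#\<^bsub>G\<^esub> H \<in> S'}"
      by blast
    then show "openin T {g \<in> topspace T. g <#\<^bsub>G\<^esub> H \<in> S \<inter> S'}"
      using S S' by auto
  next
    fix \<S> assume \<S>: "\<forall>S\<in>\<S>. ?P S"
    show "\<Union>\<S> \<subseteq> lcosets\<^bsub>G\<^esub> H" using \<S> by blast
    have "{g \<in> topspace T. g <#\<^bsub>G\<^esub> H \<in> \<Union>\<S>} =
        (\<Union>S\<in>\<S>. {g \<in> topspace T. g <#\<^bsub>G\<^esub> H \<in> S})"
      by blast
    moreover have "openin T (\<Union>S\<in>\<S>. {g \<in> topspace T. g <#\<^bsub>G\<^esub> H \<in> S})"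
      using \<S> by (intro openin_Union) auto
    ultimately show "openin T {g \<in> topspace T. g <#\<^bsub>G\<^esub> H \<in> \<Union>\<S>}"
      by (simp only:)
  qed
  then show ?thesis
    unfolding coset_topology_def by (simp only: topology_inverse')
qed

lemma (in locally_compact_group) quotient_map_coset_topology:
  "quotient_map T (coset_topology G T H) (\<lambda>g. g <#\<^bsub>G\<^esub> H)"
proof -
  have "{g \<in> topspace T. g <#\<^bsub>G\<^esub> H \<in> lcosets\<^bsub>G\<^esub> H} = topspace T"
    by (auto simp: topspace_eq_carrier LCOSETS_def)
  then have "openin (coset_topology G T H) (lcosets\<^bsub>G\<^esub> H)"
    by (simp add: openin_coset_topology)
  then have top: "topspace (coset_topology G T H) = lcosets\<^bsub>G\<^esub> H"
    by (meson openin_coset_topology openin_subset openin_topspace subset_antisym)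
  have "(\<lambda>g. g <#\<^bsub>G\<^esub> H) ` topspace T = lcosets\<^bsub>G\<^esub> H"
    unfolding topspace_eq_carrier LCOSETS_def by blast
  then show ?thesis
    unfolding quotient_map_def top openin_coset_topology by blast
qed

definition coset_translate ::
  "('g, 'm) monoid_scheme \<Rightarrow> 'g set \<Rightarrow> 'g \<Rightarrow> 'g set set \<Rightarrow> 'g set set"
  where "coset_translate G H s E =
    {(s \<otimes>\<^bsub>G\<^esub> a) <#\<^bsub>G\<^esub> H | a. a \<in> carrier G \<and> a <#\<^bsub>G\<^esub> H \<in> E}"

text \<open>The value at a coset of a function on the group that is constant on cosets.\<close>

definition coset_value :: "('g \<Rightarrow> 'b) \<Rightarrow> 'g set \<Rightarrow> 'b"
  where "coset_value f x = the_elem (f ` x)"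

lemma (in group) coset_value_l_coset:
  assumes H: "subgroup H G" and f: "\<And>h. h \<in> H \<Longrightarrow> f (g \<otimes> h) = f g"
  shows "coset_value f (g <#\<^bsub>G\<^esub> H) = f g"
proof -
  have "f ` (g <#\<^bsub>G\<^esub> H) = (\<lambda>h. f (g \<otimes> h)) ` H"
    by (simp add: l_coset_def UNION_singleton_eq_range image_image)
  moreover have "(\<lambda>h. f (g \<otimes> h)) ` H = (\<lambda>h. f g) ` H"
    by (rule image_cong[OF refl]) (rule f)
  moreover have "(\<lambda>h. f g) ` H = {f g}"
    by (rule image_constant[OF subgroup.one_closed[OF H]])
  ultimately show ?thesis
    unfolding coset_value_def by (simp only: the_elem_eq)
qed

definition rho_function ::
  "('g, 'm) monoid_scheme \<Rightarrow> 'g topology \<Rightarrow> 'g set \<Rightarrow> ('g \<Rightarrow> real) \<Rightarrow> bool"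
  where "rho_function G T H \<rho> \<longleftrightarrow>
    continuous_map T euclideanreal \<rho> \<and> (\<forall>g\<in>carrier G. 0 < \<rho> g) \<and>
    (\<forall>g\<in>carrier G. \<forall>h\<in>H. \<rho> (g \<otimes>\<^bsub>G\<^esub> h) = \<rho> g)"

text \<open>
  The measure $\mu$ arises from $\rho$ by the quotient integral formula
  $\int_G f\rho\,dm_G = \int_{G/H}\int_H f(gh)\,dm_H(h)\,d\mu(gH)$
  for all continuous compactly supported $f$.
\<close>

definition arises_from_rho ::
  "('g, 'm) monoid_scheme \<Rightarrow> 'g topology \<Rightarrow> 'g set \<Rightarrow> ('g \<Rightarrow> real) \<Rightarrow> 'g set measure \<Rightarrow> bool"
  where "arises_from_rho G T H \<rho> \<mu> \<longleftrightarrow>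
    (\<exists>mG mH. left_haar_measure G T mG \<and>
       left_haar_measure (G\<lparr>carrier := H\<rparr>) (subtopology T H) mH \<and>
       (\<forall>f :: 'g \<Rightarrow> complex.
          continuous_map T euclidean f \<longrightarrow>
          (\<exists>K. compactin T K \<and> (\<forall>g\<in>carrier G - K. f g = 0)) \<longrightarrow>
          (LINT g|mG. f g * complex_of_real (\<rho> g)) =
          (LINT x|\<mu>. coset_value (\<lambda>g. LINT h|mH. f (g \<otimes>\<^bsub>G\<^esub> h)) x)))"

definition relatively_invariant_measure ::
  "('g, 'm) monoid_scheme \<Rightarrow> 'g topology \<Rightarrow> 'g set \<Rightarrow> ('g \<Rightarrow> real) \<Rightarrow> 'g set measure \<Rightarrow> bool"
  where "relatively_invariant_measure G T H \<rho> \<mu> \<longleftrightarrow>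
    rho_function G T H \<rho> \<and> radon_measure (coset_topology G T H) \<mu> \<and>
    arises_from_rho G T H \<rho> \<mu> \<and>
    (\<forall>s\<in>carrier G. \<forall>E\<in>sets \<mu>.
       emeasure \<mu> (coset_translate G H s E) = ennreal (\<rho> s / \<rho> \<one>\<^bsub>G\<^esub>) * emeasure \<mu> E) \<and>
    (\<forall>s\<in>carrier G. \<forall>a\<in>carrier G. \<rho> (s \<otimes>\<^bsub>G\<^esub> a) * \<rho> \<one>\<^bsub>G\<^esub> = \<rho> s * \<rho> a)"

section \<open>Unitary representations of the homogeneous space\<close>

definition unitary_rep ::
  "('g, 'm) monoid_scheme \<Rightarrow> 'g topology \<Rightarrow> 'g set \<Rightarrow>
    ('g set \<Rightarrow> 'h::complex_hilbert_space \<Rightarrow> 'h) \<Rightarrow> bool"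
  where "unitary_rep G T H \<pi> \<longleftrightarrow>
    (\<forall>x\<in>lcosets\<^bsub>G\<^esub> H. unitary_operator (\<pi> x)) \<and>
    (\<forall>\<xi> \<eta>. continuous_map (coset_topology G T H) euclidean (\<lambda>x. cinner (\<pi> x \<xi>) \<eta>)) \<and>
    (\<forall>g\<in>carrier G. \<forall>k\<in>carrier G.
       \<pi> ((g \<otimes>\<^bsub>G\<^esub> k) <#\<^bsub>G\<^esub> H) = \<pi> (g <#\<^bsub>G\<^esub> H) \<circ> \<pi> (k <#\<^bsub>G\<^esub> H)) \<and>
    (\<forall>g\<in>carrier G. is_adjoint (\<pi> (g <#\<^bsub>G\<^esub> H)) (\<pi> ((inv\<^bsub>G\<^esub> g) <#\<^bsub>G\<^esub> H)))"

definition irreducible_rep ::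
  "('g, 'm) monoid_scheme \<Rightarrow> 'g set \<Rightarrow> ('g set \<Rightarrow> 'h::complex_hilbert_space \<Rightarrow> 'h) \<Rightarrow> bool"
  where "irreducible_rep G H \<pi> \<longleftrightarrow>
    (\<forall>M. closed_csubspace M \<longrightarrow> (\<forall>x\<in>lcosets\<^bsub>G\<^esub> H. \<pi> x ` M \<subseteq> M) \<longrightarrow> M = {0} \<or> M = UNIV)"

definition wavelet_constant ::
  "('g, 'm) monoid_scheme \<Rightarrow> ('g \<Rightarrow> real) \<Rightarrow> 'g set measure \<Rightarrow>
    ('g set \<Rightarrow> 'h::complex_hilbert_space \<Rightarrow> 'h) \<Rightarrow> 'h \<Rightarrow> ennreal"
  where "wavelet_constant G \<rho> \<mu> \<pi> \<xi> =
    (\<integral>\<^sup>+x. ennreal (\<rho> \<one>\<^bsub>G\<^esub> / coset_value \<rho> x * (cmod (cinner \<xi> (\<pi> x \<xi>)))\<^sup>2) \<partial>\<mu>)"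

definition admissible_wavelet ::
  "('g, 'm) monoid_scheme \<Rightarrow> ('g \<Rightarrow> real) \<Rightarrow> 'g set measure \<Rightarrow>
    ('g set \<Rightarrow> 'h::complex_hilbert_space \<Rightarrow> 'h) \<Rightarrow> 'h \<Rightarrow> bool"
  where "admissible_wavelet G \<rho> \<mu> \<pi> \<xi> \<longleftrightarrow>
    0 < wavelet_constant G \<rho> \<mu> \<pi> \<xi> \<and> wavelet_constant G \<rho> \<mu> \<pi> \<xi> < \<infinity>"

definition square_integrable_rep ::
  "('g, 'm) monoid_scheme \<Rightarrow> ('g \<Rightarrow> real) \<Rightarrow> 'g set measure \<Rightarrow>
    ('g set \<Rightarrow> 'h::complex_hilbert_space \<Rightarrow> 'h) \<Rightarrow> bool"
  where "square_integrable_rep G \<rho> \<mu> \<pi> \<longleftrightarrow> (\<exists>\<xi>. admissible_wavelet G \<rho> \<mu> \<pi> \<xi>)"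

definition wavelet_transform ::
  "('g, 'm) monoid_scheme \<Rightarrow> ('g \<Rightarrow> real) \<Rightarrow>
    ('g set \<Rightarrow> 'h::complex_hilbert_space \<Rightarrow> 'h) \<Rightarrow> 'h \<Rightarrow> 'h \<Rightarrow> 'g set \<Rightarrow> complex"
  where "wavelet_transform G \<rho> \<pi> \<xi> \<eta> x =
    complex_of_real (sqrt (\<rho> \<one>\<^bsub>G\<^esub> / coset_value \<rho> x)) * cinner \<eta> (\<pi> x \<xi>)"

text \<open>
  For admissible $\xi_1$, $\xi_2$ the integrand is a product of two square integrable functions,
  so the Bochner integral below is never the default value of a divergent integral.
\<close>

definition pair_constant ::
  "('g, 'm) monoid_scheme \<Rightarrow> ('g \<Rightarrow> real) \<Rightarrow> 'g set measure \<Rightarrow>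
    ('g set \<Rightarrow> 'h::complex_hilbert_space \<Rightarrow> 'h) \<Rightarrow> 'h \<Rightarrow> 'h \<Rightarrow> complex"
  where "pair_constant G \<rho> \<mu> \<pi> \<xi>\<^sub>1 \<xi>\<^sub>2 =
    1 / cinner \<xi>\<^sub>1 \<xi>\<^sub>2 *
    (LINT x|\<mu>. wavelet_transform G \<rho> \<pi> \<xi>\<^sub>1 \<xi>\<^sub>1 x * cnj (wavelet_transform G \<rho> \<pi> \<xi>\<^sub>2 \<xi>\<^sub>2 x))"

definition admissible_pair ::
  "('g, 'm) monoid_scheme \<Rightarrow> ('g \<Rightarrow> real) \<Rightarrow> 'g set measure \<Rightarrow>
    ('g set \<Rightarrow> 'h::complex_hilbert_space \<Rightarrow> 'h) \<Rightarrow> 'h \<Rightarrow> 'h \<Rightarrow> bool"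
  where "admissible_pair G \<rho> \<mu> \<pi> \<xi>\<^sub>1 \<xi>\<^sub>2 \<longleftrightarrow>
    admissible_wavelet G \<rho> \<mu> \<pi> \<xi>\<^sub>1 \<and> admissible_wavelet G \<rho> \<mu> \<pi> \<xi>\<^sub>2 \<and>
    cinner \<xi>\<^sub>1 \<xi>\<^sub>2 \<noteq> 0 \<and> pair_constant G \<rho> \<mu> \<pi> \<xi>\<^sub>1 \<xi>\<^sub>2 \<noteq> 0"

text \<open>
  The vector \<open>v\<close> is the weak integral over $s \cdot K'$. It is unique, and its existence is part of
  the property.
\<close>

definition homogeneous_approximation_property ::
  "('g, 'm) monoid_scheme \<Rightarrow> 'g topology \<Rightarrow> 'g set \<Rightarrow> ('g \<Rightarrow> real) \<Rightarrow> 'g set measure \<Rightarrow>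
    ('g set \<Rightarrow> 'h::complex_hilbert_space \<Rightarrow> 'h) \<Rightarrow> 'h \<Rightarrow> 'h \<Rightarrow> bool"
  where "homogeneous_approximation_property G T H \<rho> \<mu> \<pi> \<xi>\<^sub>1 \<xi>\<^sub>2 \<longleftrightarrow>
    (\<forall>\<eta>. \<forall>\<epsilon>>0. \<exists>K. compactin (coset_topology G T H) K \<and>
      (\<forall>K'. compactin (coset_topology G T H) K' \<longrightarrow> K \<subseteq> K' \<longrightarrow>
        (\<forall>s\<in>carrier G. \<exists>v.
          has_weak_integral \<mu> (coset_translate G H s K')
            (\<lambda>x. (complex_of_real (sqrt (\<rho> \<one>\<^bsub>G\<^esub> / coset_value \<rho> x)) *
                  wavelet_transform G \<rho> \<pi> \<xi>\<^sub>1 (\<pi> (s <#\<^bsub>G\<^esub> H) \<eta>) x) *\<^sub>C \<pi> x \<xi>\<^sub>2) v \<and>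
          norm (\<pi> (s <#\<^bsub>G\<^esub> H) \<eta> - inverse (pair_constant G \<rho> \<mu> \<pi> \<xi>\<^sub>1 \<xi>\<^sub>2) *\<^sub>C v) \<le> \<epsilon>)))"

end

theory Submission
  imports Defs
begin

text \<open>
  Let \<open>\<nu>\<close> be the measure with density \<open>\<rho>(e) / \<rho>\<close> with respect to \<open>\<mu>\<close>. It is invariant under \<open>G\<close>
  (\<open>invariant_measure_translate\<close>), and in terms of \<open>\<nu>\<close> all weights disappear: the partial
  reconstruction over a set \<open>A\<close> is the weak integral of \<open>\<langle>\<eta>, \<pi>(x) \<xi>\<^sub>1\<rangle> \<pi>(x) \<xi>\<^sub>2\<close> over \<open>A\<close>.

  The heart of the matter are the orthogonality relations
  \<open>\<integral> \<langle>\<eta>, \<pi>(x) \<xi>\<^sub>1\<rangle> \<langle>\<pi>(x) \<xi>\<^sub>2, \<zeta>\<rangle> d\<nu>(x) = c \<langle>\<eta>, \<zeta>\<rangle>\<close> (\<open>orthogonality_relations\<close>), where \<open>c\<close> is the constant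
  of the pair, as \<open>\<eta> = \<xi>\<^sub>1\<close> and \<open>\<zeta> = \<xi>\<^sub>2\<close> show. They follow by polarization from the case
  \<open>\<integral> \<bar>\<langle>\<eta>, \<pi>(x) \<xi>\<rangle>\<bar>\<^sup>2 d\<nu>(x) = c \<parallel>\<eta>\<parallel>\<^sup>2\<close>. Here the left side is a quadratic form in \<open>\<eta>\<close> that is invariant
  under the representation, lower semicontinuous by Fatou's lemma, and finite at one nonzero vector,
  but a priori infinite elsewhere. Schur's lemma for such forms (\<open>invariant_form_scalar\<close>) says that
  irreducibility forces it to be a multiple of the squared norm. To prove it, let \<open>prox x\<close> minimize
  \<open>\<parallel>u - x\<parallel>\<^sup>2 + Q u\<close> over \<open>u\<close>. This is a bounded self-adjoint intertwiner, hence a scalar by the bounded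
  Schur lemma (\<open>selfadjoint_intertwiner_scalar\<close>), and the minimizer determines \<open>Q\<close>. The bounded lemma
  rests on the square root of a positive operator, which is the limit of a norm-convergent iteration.

  Given the orthogonality relations, \<open>c \<eta>\<close> minus the partial integral over \<open>A\<close> is the integral over
  the complement of \<open>A\<close>, and by Cauchy-Schwarz its norm is at most a constant times the \<open>L\<^sup>2\<close> norm of
  \<open>x \<mapsto> \<langle>\<eta>, \<pi>(x) \<xi>\<^sub>1\<rangle>\<close> on that complement (\<open>partial_integral_error\<close>). By \<open>\<sigma>\<close>-compactness this is small
  for a suitable compact set, and by invariance of \<open>\<nu>\<close> the estimate for \<open>\<pi>(s H) \<eta>\<close> on \<open>s \<cdot> K'\<close> is the
  estimate for \<open>\<eta>\<close> on \<open>K'\<close>.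
\<close>

section \<open>Elementary Hilbert space geometry\<close>

lemma scaleC_one [simp]: "1 *\<^sub>C x = (x::'h::complex_hilbert_space)"
  using scaleR_scaleC[of 1 x] by simp

lemma scaleC_zero_left [simp]: "0 *\<^sub>C x = (0::'h::complex_hilbert_space)"
  using scaleR_scaleC[of 0 x] by simp

lemma scaleC_zero_right [simp]: "c *\<^sub>C 0 = (0::'h::complex_hilbert_space)"
  using scaleC_scaleC[of c 0 0] by simp

lemma scaleC_minus_one: "(-1) *\<^sub>C x = - (x::'h::complex_hilbert_space)"
  using scaleR_scaleC[of "-1" x] by simp

lemma scaleC_minus_right: "c *\<^sub>C (- x) = - (c *\<^sub>C (x::'h::complex_hilbert_space))"
  by (metis scaleC_minus_one scaleC_scaleC mult.commute)

lemma scaleC_diff_right: "c *\<^sub>C (x - y) = c *\<^sub>C x - c *\<^sub>C (y::'h::complex_hilbert_space)"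
  using scaleC_add_right[of c x "- y"] by (simp add: scaleC_minus_right)

lemma cinner_scaleR_left:
  "cinner (r *\<^sub>R x) y = complex_of_real r * cinner x (y::'h::complex_hilbert_space)"
  by (simp add: scaleR_scaleC cinner_scaleC_left)

lemma cinner_zero_left [simp]: "cinner 0 (y::'h::complex_hilbert_space) = 0"
  using cinner_scaleC_left[of 0 0 y] by simp

lemma cinner_minus_left: "cinner (- x) y = - cinner x (y::'h::complex_hilbert_space)"
  using cinner_scaleC_left[of "-1" x y] by (simp add: scaleC_minus_one)

lemma cinner_diff_left:
  "cinner (x - z) y = cinner x y - cinner z (y::'h::complex_hilbert_space)"
  using cinner_add_left[of x "- z" y] by (simp add: cinner_minus_left)

lemma cinner_add_right:
  "cinner x (y + z) = cinner x y + cinner x (z::'h::complex_hilbert_space)"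
  by (metis cinner_add_left cinner_commute complex_cnj_add)

lemma cinner_scaleC_right:
  "cinner x (c *\<^sub>C y) = cnj c * cinner x (y::'h::complex_hilbert_space)"
  by (metis cinner_scaleC_left cinner_commute complex_cnj_mult)

lemma cinner_scaleR_right:
  "cinner x (r *\<^sub>R y) = complex_of_real r * cinner x (y::'h::complex_hilbert_space)"
  by (simp add: scaleR_scaleC cinner_scaleC_right)

lemma cinner_zero_right [simp]: "cinner (y::'h::complex_hilbert_space) 0 = 0"
  by (metis cinner_zero_left cinner_commute complex_cnj_zero)

lemma cinner_diff_right:
  "cinner x (y - z) = cinner x y - cinner x (z::'h::complex_hilbert_space)"
  by (metis cinner_diff_left cinner_commute complex_cnj_diff)

lemmas cinner_simps = cinner_add_left cinner_add_right cinner_diff_left cinner_diff_right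
  cinner_scaleC_left cinner_scaleC_right

lemma cinner_self: "cinner x x = complex_of_real ((norm (x::'h::complex_hilbert_space))\<^sup>2)"
proof -
  have "0 \<le> Re (cinner x x)"
    using norm_ge_zero[of x] unfolding norm_eq_sqrt_cinner by simp
  then have "(norm x)\<^sup>2 = Re (cinner x x)"
    unfolding norm_eq_sqrt_cinner by simp
  moreover have "Im (cinner x x) = 0"
    using arg_cong[OF cinner_commute[of x x], of Im] by simp
  ultimately show ?thesis by (simp add: complex_eq_iff)
qed

lemma norm_sq_eq_cinner: "(norm x)\<^sup>2 = Re (cinner x (x::'h::complex_hilbert_space))"
  by (simp add: cinner_self)

lemma Re_cinner_commute: "Re (cinner x y) = Re (cinner y (x::'h::complex_hilbert_space))"
  using arg_cong[OF cinner_commute[of x y], of Re] by simp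

lemma norm_add_sq:
  "(norm (x + y))\<^sup>2 = (norm x)\<^sup>2 + 2 * Re (cinner x y) + (norm (y::'h::complex_hilbert_space))\<^sup>2"
  using Re_cinner_commute[of x y] by (simp add: norm_sq_eq_cinner cinner_simps)

lemma norm_diff_sq:
  "(norm (x - y))\<^sup>2 = (norm x)\<^sup>2 - 2 * Re (cinner x y) + (norm (y::'h::complex_hilbert_space))\<^sup>2"
  using Re_cinner_commute[of x y] by (simp add: norm_sq_eq_cinner cinner_simps)

lemma norm_parallelogram:
  "(norm (x + y))\<^sup>2 + (norm (x - y))\<^sup>2 = 2 * (norm x)\<^sup>2 + 2 * (norm (y::'h::complex_hilbert_space))\<^sup>2"
  by (simp add: norm_add_sq norm_diff_sq)

lemma norm_scaleC [simp]: "norm (c *\<^sub>C x) = cmod c * norm (x::'h::complex_hilbert_space)"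
proof -
  have "complex_of_real ((norm (c *\<^sub>C x))\<^sup>2) = complex_of_real ((cmod c * norm x)\<^sup>2)"
  proof -
    have "cinner (c *\<^sub>C x) (c *\<^sub>C x) = c * cnj c * cinner x x"
      by (simp add: cinner_scaleC_left cinner_scaleC_right)
    then show ?thesis
      by (simp only: cinner_self of_real_mult power_mult_distrib complex_norm_square)
  qed
  then have "(norm (c *\<^sub>C x))\<^sup>2 = (cmod c * norm x)\<^sup>2"
    using of_real_eq_iff by blast
  then show ?thesis by (simp add: power2_eq_iff_nonneg)
qed

lemma cinner_Cauchy_Schwarz: "cmod (cinner x y) \<le> norm x * norm (y::'h::complex_hilbert_space)"
proof (cases "y = 0")
  case False
  define a where "a = cinner x y / complex_of_real ((norm y)\<^sup>2)"
  have n: "(norm y)\<^sup>2 > 0" using False by simp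
  have "cinner (x - a *\<^sub>C y) y = 0"
    using n by (simp add: cinner_simps a_def cinner_self)
  then have "cinner (a *\<^sub>C y) (x - a *\<^sub>C y) = 0"
    using cinner_commute[of y "x - a *\<^sub>C y"] by (simp add: cinner_scaleC_left)
  then have "(norm x)\<^sup>2 = (norm (a *\<^sub>C y))\<^sup>2 + (norm (x - a *\<^sub>C y))\<^sup>2"
    using norm_add_sq[of "a *\<^sub>C y" "x - a *\<^sub>C y"] by simp
  then have "(norm (a *\<^sub>C y))\<^sup>2 \<le> (norm x)\<^sup>2" by simp
  then have "norm (a *\<^sub>C y) \<le> norm x" by simp
  moreover have "norm (a *\<^sub>C y) = cmod (cinner x y) / norm y"
    using False by (simp add: a_def norm_divide norm_mult power2_eq_square)
  ultimately have "cmod (cinner x y) / norm y \<le> norm x" by linarith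
  then show ?thesis using False by (simp add: pos_divide_le_eq)
qed simp

lemma bounded_bilinear_cinner:
  "bounded_bilinear (cinner :: 'h::complex_hilbert_space \<Rightarrow> 'h \<Rightarrow> complex)"
proof
  show "\<exists>K. \<forall>x y::'h. norm (cinner x y) \<le> norm x * norm y * K"
    by (intro exI[of _ 1]) (simp add: cinner_Cauchy_Schwarz)
qed (simp_all add: cinner_simps cinner_scaleR_left cinner_scaleR_right scaleR_conv_of_real)

lemmas tendsto_cinner [tendsto_intros] = bounded_bilinear.tendsto[OF bounded_bilinear_cinner]

lemma bounded_linear_scaleC:
  "bounded_linear (\<lambda>x::'h::complex_hilbert_space. c *\<^sub>C x)"
  by (rule bounded_linear_intro[where K = "cmod c"])
     (simp_all add: scaleC_add_right scaleR_scaleC scaleC_scaleC mult.commute)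

text \<open>
  Over the complex numbers the diagonal determines a sesquilinear form: replacing \<open>y\<close> by \<open>\<i>y\<close>
  separates the two mixed terms of \<open>B (x + y) (x + y)\<close>.
\<close>

lemma sesquilinear_zero_diagonal:
  fixes B :: "'h::complex_hilbert_space \<Rightarrow> 'h \<Rightarrow> complex"
  assumes addl: "\<And>x y z. B (x + y) z = B x z + B y z"
    and addr: "\<And>x y z. B x (y + z) = B x y + B x z"
    and scl: "\<And>c x y. B (c *\<^sub>C x) y = c * B x y"
    and scr: "\<And>c x y. B x (c *\<^sub>C y) = cnj c * B x y"
    and diag: "\<And>x. B x x = 0"
  shows "B x y = 0"
proof -
  have 1: "B x y + B y x = 0" for x y
  proof -
    have "B (x + y) (x + y) = B x y + B y x"
      by (simp only: addl addr) (simp add: diag)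
    then show ?thesis using diag[of "x + y"] by simp
  qed
  have "- \<i> * B x y + \<i> * B y x = 0"
    using 1[of x "\<i> *\<^sub>C y"] by (simp add: scl scr)
  then have "B x y = B y x" by (simp add: algebra_simps)
  with 1[of x y] show ?thesis by simp
qed

section \<open>Square roots and the bounded Schur lemma\<close>

text \<open>
  The iteration \<open>Y \<mapsto> (A + Y\<^sup>2) / 2\<close> solves \<open>(1 - Y)\<^sup>2 = 1 - A\<close>. It converges in norm because it is
  dominated by its scalar instance \<open>y \<mapsto> (1 + y\<^sup>2) / 2\<close>, which increases from \<open>0\<close> to \<open>1\<close>.
\<close>

primrec sqrt_iter :: "('h::real_normed_vector \<Rightarrow>\<^sub>L 'h) \<Rightarrow> nat \<Rightarrow> ('h \<Rightarrow>\<^sub>L 'h)"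
  where "sqrt_iter A 0 = 0"
  | "sqrt_iter A (Suc n) = (1 / 2) *\<^sub>R (A + (sqrt_iter A n o\<^sub>L sqrt_iter A n))"

primrec scalar_iter :: "nat \<Rightarrow> real"
  where "scalar_iter 0 = 0"
  | "scalar_iter (Suc n) = (1 + (scalar_iter n)\<^sup>2) / 2"

lemma scalar_iter_bounds: "0 \<le> scalar_iter n \<and> scalar_iter n \<le> 1"
  by (induction n) (auto simp: power_le_one)

lemma scalar_iter_incseq: "incseq scalar_iter"
proof (rule incseq_SucI)
  fix n
  have "0 \<le> (1 - scalar_iter n)\<^sup>2" by simp
  then show "scalar_iter n \<le> scalar_iter (Suc n)" by (simp add: power2_eq_square algebra_simps)
qed

lemma norm_sqrt_iter:
  assumes "norm A \<le> 1" shows "norm (sqrt_iter A n) \<le> scalar_iter n"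
proof (induction n)
  case (Suc n)
  have "norm (sqrt_iter A n o\<^sub>L sqrt_iter A n) \<le> (scalar_iter n)\<^sup>2"
    using norm_blinfun_compose[of "sqrt_iter A n" "sqrt_iter A n"]
      mult_mono[OF Suc Suc] scalar_iter_bounds[of n]
    by (simp add: power2_eq_square)
  then show ?case
    using assms norm_triangle_ineq[of A "(sqrt_iter A n o\<^sub>L sqrt_iter A n)"] by simp
qed simp

lemma norm_sqrt_iter_diff:
  assumes "norm A \<le> 1" "n \<le> m"
  shows "norm (sqrt_iter A m - sqrt_iter A n) \<le> scalar_iter m - scalar_iter n"
  using assms(2)
proof (induction n arbitrary: m)
  case 0
  then show ?case using norm_sqrt_iter[OF assms(1), of m] by simp
next
  case (Suc n)
  then obtain k where m: "m = Suc k" and k: "n \<le> k" by (cases m) auto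
  let ?Y = "sqrt_iter A k" and ?Z = "sqrt_iter A n"
  have "sqrt_iter A m - sqrt_iter A (Suc n)
      = (1 / 2) *\<^sub>R ((?Y o\<^sub>L (?Y - ?Z)) + ((?Y - ?Z) o\<^sub>L ?Z))"
    by (rule blinfun_eqI)
       (simp add: m blinfun.bilinear_simps algebra_simps)
  also have "norm \<dots> \<le> (norm (?Y o\<^sub>L (?Y - ?Z)) + norm ((?Y - ?Z) o\<^sub>L ?Z)) / 2"
    using norm_triangle_ineq by simp
  also have "\<dots> \<le> (norm ?Y * norm (?Y - ?Z) + norm (?Y - ?Z) * norm ?Z) / 2"
    by (intro divide_right_mono add_mono norm_blinfun_compose) simp
  also have "\<dots> = (norm ?Y + norm ?Z) * norm (?Y - ?Z) / 2" by (simp add: algebra_simps)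
  also have "\<dots> \<le> (scalar_iter k + scalar_iter n) * (scalar_iter k - scalar_iter n) / 2"
    using scalar_iter_bounds[of k] scalar_iter_bounds[of n]
    by (intro divide_right_mono mult_mono add_mono norm_sqrt_iter[OF assms(1)] Suc.IH k) auto
  also have "\<dots> = scalar_iter m - scalar_iter (Suc n)"
    by (simp add: m power2_eq_square algebra_simps diff_divide_distrib add_divide_distrib)
  finally show ?case .
qed

lemma blinfun_sqrt_exists:
  fixes A :: "'h::banach \<Rightarrow>\<^sub>L 'h"
  assumes A: "norm A \<le> 1"
  shows "\<exists>Y :: 'h \<Rightarrow>\<^sub>L 'h. norm Y \<le> 1 \<and> (\<forall>x. 2 *\<^sub>R blinfun_apply Y x = blinfun_apply A x + blinfun_apply Y (blinfun_apply Y x)) \<and>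
    (\<forall>B. B o\<^sub>L A = A o\<^sub>L B \<longrightarrow> B o\<^sub>L Y = Y o\<^sub>L B)"
proof -
  let ?Y = "sqrt_iter A"
  have "convergent scalar_iter"
    using incseq_convergent[OF scalar_iter_incseq, of 1] scalar_iter_bounds
    by (metis convergentI)
  then have C: "Cauchy scalar_iter" by (rule convergent_Cauchy)
  have "Cauchy ?Y"
  proof (rule metric_CauchyI)
    fix e :: real assume "0 < e"
    then obtain N where N: "\<And>m n. m \<ge> N \<Longrightarrow> n \<ge> N \<Longrightarrow> dist (scalar_iter m) (scalar_iter n) < e"
      using metric_CauchyD[OF C] by blast
    have "dist (?Y m) (?Y n) < e" if "m \<ge> N" "n \<ge> N" for m n
      using N[OF that] norm_sqrt_iter_diff[OF A, of n m] norm_sqrt_iter_diff[OF A, of m n]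
      by (cases "n \<le> m") (auto simp: dist_norm norm_minus_commute)
    then show "\<exists>M. \<forall>m\<ge>M. \<forall>n\<ge>M. dist (?Y m) (?Y n) < e" by blast
  qed
  then obtain Y where Y: "?Y \<longlonglongrightarrow> Y"
    using Cauchy_convergent convergent_def by blast
  have n: "norm Y \<le> 1"
  proof (rule LIMSEQ_le_const2[OF tendsto_norm[OF Y]])
    show "\<exists>N. \<forall>n\<ge>N. norm (?Y n) \<le> 1"
      using norm_sqrt_iter[OF A] scalar_iter_bounds order_trans by blast
  qed
  have lim: "(\<lambda>n. ?Y n o\<^sub>L ?Y n) \<longlonglongrightarrow> (Y o\<^sub>L Y)"
    by (rule bounded_bilinear.tendsto[OF bounded_bilinear_blinfun_compose Y Y])
  have "(\<lambda>n. ?Y (Suc n)) \<longlonglongrightarrow> (1 / 2) *\<^sub>R (A + (Y o\<^sub>L Y))"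
    unfolding sqrt_iter.simps by (intro tendsto_intros lim)
  then have fixed: "Y = (1 / 2) *\<^sub>R (A + (Y o\<^sub>L Y))"
    using LIMSEQ_unique LIMSEQ_Suc[OF Y] by blast
  have "2 *\<^sub>R blinfun_apply Y x = blinfun_apply A x + blinfun_apply Y (blinfun_apply Y x)" for x
  proof -
    have "2 *\<^sub>R Y x = 2 *\<^sub>R ((1 / 2) *\<^sub>R (A + (Y o\<^sub>L Y))) x" using fixed by simp
    then show ?thesis by (simp add: blinfun.bilinear_simps scaleR_add_right)
  qed
  moreover have "B o\<^sub>L Y = Y o\<^sub>L B" if B: "B o\<^sub>L A = A o\<^sub>L B" for B
  proof -
    have BA: "B (A x) = A (B x)" for x
      using B by (metis blinfun_apply_blinfun_compose)
    have c: "B (?Y n x) = ?Y n (B x)" for n x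
      by (induction n arbitrary: x) (simp_all add: blinfun.bilinear_simps BA)
    have "B o\<^sub>L ?Y n = ?Y n o\<^sub>L B" for n
      by (rule blinfun_eqI) (simp add: c)
    moreover have "(\<lambda>n. B o\<^sub>L ?Y n) \<longlonglongrightarrow> (B o\<^sub>L Y)" "(\<lambda>n. ?Y n o\<^sub>L B) \<longlonglongrightarrow> (Y o\<^sub>L B)"
      by (intro bounded_bilinear.tendsto[OF bounded_bilinear_blinfun_compose] tendsto_const Y)+
    ultimately show ?thesis using LIMSEQ_unique by fastforce
  qed
  ultimately show ?thesis using n by blast
qed

definition irreducible_family :: "('h::complex_hilbert_space \<Rightarrow> 'h) set \<Rightarrow> bool"
  where "irreducible_family P \<longleftrightarrow>
    (\<forall>M. closed_csubspace M \<longrightarrow> (\<forall>U\<in>P. U ` M \<subseteq> M) \<longrightarrow> M = {0} \<or> M = UNIV)"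

lemma unitary_norm: "unitary_operator U \<Longrightarrow> norm (U x) = norm x"
  by (simp add: unitary_operator_def norm_eq_sqrt_cinner)

lemma unitary_bounded_linear: "unitary_operator U \<Longrightarrow> bounded_linear U"
  by (rule bounded_linear_intro[where K = 1])
     (simp_all add: unitary_norm, simp_all add: unitary_operator_def scaleR_scaleC)

lemma closed_csubspace_kernel:
  assumes "bounded_linear f" and "\<And>c x. f (c *\<^sub>C x) = c *\<^sub>C f x"
  shows "closed_csubspace {x. f x = 0}"
proof -
  interpret bounded_linear f by fact
  have "closed {x. f x = 0}"
    by (intro closed_Collect_eq continuous_on_const linear_continuous_on[OF assms(1)])
  then show ?thesis by (simp add: closed_csubspace_def zero add assms(2))
qed

text \<open>The kernel of an intertwiner is an invariant closed subspace.\<close>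

lemma irreducible_family_kernel:
  assumes "irreducible_family P" and "bounded_linear f" and "\<And>c x. f (c *\<^sub>C x) = c *\<^sub>C f x"
    and "\<And>U x. U \<in> P \<Longrightarrow> f (U x) = U (f x)" and "\<And>U. U \<in> P \<Longrightarrow> U 0 = 0"
    and "f z = 0" and "z \<noteq> 0"
  shows "f x = 0"
proof -
  have "\<forall>U\<in>P. U ` {x. f x = 0} \<subseteq> {x. f x = 0}"
  proof (intro ballI subsetI)
    fix U y assume U: "U \<in> P" and "y \<in> U ` {x. f x = 0}"
    then obtain x where "y = U x" "f x = 0" by blast
    then show "y \<in> {x. f x = 0}"
      using assms(4)[OF U, of x] assms(5)[OF U] by simp
  qed
  then have "{x. f x = 0} = {0} \<or> {x. f x = 0} = UNIV"
    using assms(1)[unfolded irreducible_family_def, rule_format,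
        OF closed_csubspace_kernel[OF assms(2,3)]] by simp
  moreover have "z \<in> {x. f x = 0}" "z \<notin> {0}" using assms(6,7) by simp_all
  ultimately have "{x. f x = 0} = UNIV" by metis
  then show ?thesis by (simp add: set_eq_iff)
qed

lemma norm_blinfun_contraction:
  assumes "norm B \<le> 1" shows "norm (blinfun_apply B x) \<le> norm x"
  using norm_blinfun[of B x] mult_right_mono[OF assms, of "norm x"] by simp

text \<open>
  This takes the place of the spectral theorem. With \<open>R\<close> the positive square root of \<open>S\<^sup>2\<close> one has
  \<open>(R - S) (R + S) = 0\<close>. The kernel of the intertwiner \<open>R - S\<close> is trivial or everything, which forces
  \<open>S = - R\<close> or \<open>S = R\<close>.
\<close>

lemma selfadjoint_intertwiner_definite:
  fixes S :: "'h::complex_hilbert_space \<Rightarrow>\<^sub>L 'h"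
  assumes irr: "irreducible_family P" and P: "\<And>U. U \<in> P \<Longrightarrow> bounded_linear U"
    and n: "norm S \<le> 1" and sa: "\<And>x y. cinner (blinfun_apply S x) y = cinner x (blinfun_apply S y)"
    and SC: "\<And>c x. blinfun_apply S (c *\<^sub>C x) = c *\<^sub>C blinfun_apply S x"
    and SP: "\<And>U x. U \<in> P \<Longrightarrow> blinfun_apply S (U x) = U (blinfun_apply S x)"
  shows "(\<forall>x. 0 \<le> Re (cinner (blinfun_apply S x) x)) \<or> (\<forall>x. Re (cinner (blinfun_apply S x) x) \<le> 0)"
proof -
  \<comment> \<open>If \<open>(1 - Y)\<^sup>2 = 1 - A\<close>, then \<open>1 - Y\<close> is a square root of \<open>S\<^sup>2\<close>.\<close>
  define A where "A = id_blinfun - (S o\<^sub>L S)"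
  have A: "A x = x - S (S x)" for x by (simp add: A_def blinfun.bilinear_simps)
  have "norm (A x) \<le> 1 * norm x" for x
  proof -
    have "(norm (A x))\<^sup>2 = (norm x)\<^sup>2 - 2 * (norm (S x))\<^sup>2 + (norm (S (S x)))\<^sup>2"
      by (simp add: A norm_diff_sq sa[symmetric] norm_sq_eq_cinner[of "S x"])
    moreover have "(norm (S (S x)))\<^sup>2 \<le> (norm (S x))\<^sup>2"
      by (intro power_mono norm_blinfun_contraction n norm_ge_zero)
    ultimately have "(norm (A x))\<^sup>2 \<le> (norm x)\<^sup>2"
      using zero_le_power2[of "norm (S x)"] by linarith
    then show ?thesis by simp
  qed
  then have "norm A \<le> 1" by (intro norm_blinfun_bound) auto
  then obtain Y where Y1: "norm Y \<le> 1"
    and Y2: "\<And>x. 2 *\<^sub>R blinfun_apply Y x = blinfun_apply A x + blinfun_apply Y (blinfun_apply Y x)"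
    and Y3: "\<And>B. B o\<^sub>L A = A o\<^sub>L B \<Longrightarrow> B o\<^sub>L Y = Y o\<^sub>L B"
    using blinfun_sqrt_exists[of A] by blast
  have comm: "f (Y x) = Y (f x)"
    if f: "bounded_linear f" and fS: "\<And>x. f (S x) = S (f x)" for f x
  proof -
    interpret f: bounded_linear f by fact
    have "Blinfun f o\<^sub>L A = A o\<^sub>L Blinfun f"
      by (rule blinfun_eqI) (simp add: bounded_linear_Blinfun_apply[OF f] A f.diff fS)
    from Y3[OF this] have "(Blinfun f o\<^sub>L Y) x = (Y o\<^sub>L Blinfun f) x" by simp
    then show ?thesis by (simp add: bounded_linear_Blinfun_apply[OF f])
  qed
  define R where "R = id_blinfun - Y"
  have R: "R x = x - Y x" for x by (simp add: R_def blinfun.bilinear_simps)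
  have R2: "R (R x) = S (S x)" for x
    using Y2[of x] by (simp add: R A blinfun.bilinear_simps scaleR_2 algebra_simps)
  have RS: "R (S x) = S (R x)" for x
    using comm[OF blinfun.bounded_linear_right, of S x] by (simp add: R blinfun.bilinear_simps)
  have Rpos: "0 \<le> Re (cinner (R x) x)" for x
  proof -
    have "Re (cinner (Y x) x) \<le> norm (Y x) * norm x"
      using cinner_Cauchy_Schwarz complex_Re_le_cmod order_trans by blast
    also have "\<dots> \<le> norm x * norm x"
      by (intro mult_right_mono norm_blinfun_contraction Y1 norm_ge_zero)
    finally show ?thesis
      by (simp add: R cinner_diff_left cinner_self power2_eq_square)
  qed
  show ?thesis
  proof (cases "\<forall>x. R x + S x = 0")
    case True
    then have "S x = - R x" for x by (simp add: eq_neg_iff_add_eq_0 add.commute)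
    then show ?thesis using Rpos by (simp add: cinner_minus_left)
  next
    case False
    then obtain x0 where x0: "R x0 + S x0 \<noteq> 0" by blast
    let ?D = "R - S"
    have D: "?D x = R x - S x" for x by (simp add: blinfun.bilinear_simps)
    have "?D x = 0" for x
    proof (rule irreducible_family_kernel[OF irr blinfun.bounded_linear_right])
      show "?D (c *\<^sub>C y) = c *\<^sub>C ?D y" for c y
        using comm[OF bounded_linear_scaleC SC[symmetric], of c y]
        by (simp add: D R SC scaleC_diff_right)
      show "?D (U y) = U (?D y)" if "U \<in> P" for U y
      proof -
        interpret U: bounded_linear U using P that .
        show ?thesis
          using comm[OF P[OF that] SP[OF that, symmetric], of y] SP[OF that]
          by (simp add: D R U.diff)
      qed
      show "U 0 = 0" if "U \<in> P" for U
        using linear_0[OF bounded_linear.linear[OF P[OF that]]] .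
      show "?D (R x0 + S x0) = 0"
        by (simp add: D blinfun.bilinear_simps R2 RS)
    qed (fact x0)
    then have "S x = R x" for x by (simp add: D)
    then show ?thesis using Rpos by simp
  qed
qed

lemma linear_coefficient_zero:
  fixes a b :: real
  assumes "\<And>t. 0 \<le> 2 * t * a + t\<^sup>2 * b"
  shows "a = 0"
proof (rule ccontr)
  assume a: "a \<noteq> 0"
  define k where "k = \<bar>b\<bar> + 1"
  have k: "k > 0" "b < k" by (auto simp: k_def)
  define w where "w = a / k"
  have w: "a = k * w" "w \<noteq> 0" using a k by (auto simp: w_def)
  have "0 \<le> 2 * (- w) * a + (- w)\<^sup>2 * b" by (rule assms)
  also have "\<dots> = w\<^sup>2 * (b - 2 * k)"
    by (simp add: w(1) power2_eq_square algebra_simps)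
  also have "\<dots> < 0" using w(2) k by (intro mult_pos_neg) auto
  finally show False by simp
qed

text \<open>
  Subtract from \<open>T\<close> the scalar for which \<open>\<langle>T u, u\<rangle>\<close> becomes \<open>0\<close> at one vector \<open>u \<noteq> 0\<close>. The difference
  \<open>S\<close> is definite, so \<open>u\<close> is an extremum of its quadratic form and hence lies in the kernel of \<open>S\<close>.
\<close>

lemma selfadjoint_intertwiner_scalar:
  fixes T :: "'h::complex_hilbert_space \<Rightarrow> 'h"
  assumes irr: "irreducible_family P" and P: "\<And>U. U \<in> P \<Longrightarrow> bounded_linear U"
    and T: "bounded_linear T" and sa: "\<And>x y. cinner (T x) y = cinner x (T y)"
    and TC: "\<And>c x. T (c *\<^sub>C x) = c *\<^sub>C T x"
    and TP: "\<And>U x. U \<in> P \<Longrightarrow> T (U x) = U (T x)"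
  shows "\<exists>c::real. \<forall>x. T x = c *\<^sub>R x"
proof (cases "\<exists>u::'h. u \<noteq> 0")
  case False
  then have "T x = 0 *\<^sub>R x" for x by metis
  then show ?thesis by blast
next
  case True
  then obtain u :: 'h where u: "u \<noteq> 0" by blast
  interpret T: bounded_linear T by fact
  define c where "c = Re (cinner (T u) u) / (norm u)\<^sup>2"
  define S0 where "S0 = Blinfun T - c *\<^sub>R id_blinfun"
  \<comment> \<open>The factor only normalizes \<open>S0\<close> to norm at most \<open>1\<close>. Adding \<open>1\<close> covers \<open>S0 = 0\<close>.\<close>
  define r where "r = 1 / (norm S0 + 1)"
  define S where "S = r *\<^sub>R S0"
  have r: "r > 0" by (simp add: r_def add_nonneg_pos)
  have S: "S x = r *\<^sub>R (T x - c *\<^sub>R x)" for x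
    by (simp add: S_def S0_def blinfun.bilinear_simps bounded_linear_Blinfun_apply[OF T])
  have n: "norm S \<le> 1"
    using r by (simp add: S_def r_def)
  have saS: "cinner (S x) y = cinner x (S y)" for x y
    by (simp add: S cinner_scaleR_left cinner_scaleR_right cinner_simps sa)
  have SC: "S (a *\<^sub>C x) = a *\<^sub>C S x" for a x
    by (simp add: S TC scaleR_scaleC scaleC_diff_right scaleC_scaleC ac_simps)
  have SP: "S (U x) = U (S x)" if "U \<in> P" for U x
  proof -
    interpret U: bounded_linear U using P that .
    show ?thesis by (simp add: S U.scaleR U.diff TP[OF that])
  qed
  have Su: "Re (cinner (S u) u) = 0"
    using u by (simp add: S cinner_scaleR_left cinner_diff_left cinner_self c_def)
  have expand: "Re (cinner (S (u + t *\<^sub>R v)) (u + t *\<^sub>R v))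
      = 2 * t * Re (cinner (S u) v) + t\<^sup>2 * Re (cinner (S v) v)" for t v
  proof -
    have "Re (cinner (S v) u) = Re (cinner (S u) v)"
      using saS[of v u] Re_cinner_commute[of v "S u"] by simp
    then show ?thesis
      by (simp add: blinfun.bilinear_simps cinner_simps cinner_scaleR_left cinner_scaleR_right Su
          power2_eq_square algebra_simps)
  qed
  have "Re (cinner (S u) v) = 0" for v
    using selfadjoint_intertwiner_definite[OF irr P n saS SC SP]
  proof
    assume "\<forall>x. 0 \<le> Re (cinner (S x) x)"
    then show ?thesis
      by (intro linear_coefficient_zero[where b = "Re (cinner (S v) v)"])
         (simp only: expand[symmetric])
  next
    assume neg: "\<forall>x. Re (cinner (S x) x) \<le> 0"
    then have "0 \<le> 2 * t * - Re (cinner (S u) v) + t\<^sup>2 * - Re (cinner (S v) v)" for t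
    proof -
      have "Re (cinner (S (u + t *\<^sub>R v)) (u + t *\<^sub>R v)) \<le> 0" using neg by blast
      then show ?thesis unfolding expand by simp
    qed
    from linear_coefficient_zero[OF this] show ?thesis by simp
  qed
  from this[of "S u"] have Su0: "S u = 0" by (simp add: cinner_self)
  have "S x = 0" for x
  proof (rule irreducible_family_kernel[OF irr blinfun.bounded_linear_right])
    show "U 0 = 0" if "U \<in> P" for U
      using linear_0[OF bounded_linear.linear[OF P[OF that]]] .
  qed (rule SC SP Su0 u; assumption?)+
  then have "T x = c *\<^sub>R x" for x
    using r by (simp add: S)
  then show ?thesis by blast
qed

section \<open>Lower semicontinuous quadratic forms\<close>

text \<open>
  These are the squared norms of closed, possibly unbounded, operators, with value \<open>\<infinity>\<close> outside the
  domain. Working with the form alone avoids partially defined operators and adjoints.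
\<close>

locale lsc_quadratic_form =
  fixes Q :: "'h::complex_hilbert_space \<Rightarrow> ennreal"
  assumes homogeneous: "Q (c *\<^sub>C u) = ennreal ((cmod c)\<^sup>2) * Q u"
    and parallelogram: "Q (u + v) + Q (u - v) = 2 * Q u + 2 * Q v"
    and closed_sublevel: "closed {u. Q u \<le> K}"
begin

lemma zero [simp]: "Q 0 = 0"
  using homogeneous[of 0 0] by simp

text \<open>
  The infimum of the energy is the Moreau envelope of \<open>Q\<close>, up to normalization, and its minimizer
  \<open>prox x\<close> is \<open>(1 + A\<^sup>* A)\<^sup>-\<^sup>1 x\<close> when \<open>Q u = \<parallel>A u\<parallel>\<^sup>2\<close> with \<open>A\<close> closed and densely defined.
  Minimization produces this bounded operator directly.
\<close>

definition energy :: "'h \<Rightarrow> 'h \<Rightarrow> ennreal"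
  where "energy x u = ennreal ((norm (u - x))\<^sup>2) + Q u"

definition envelope :: "'h \<Rightarrow> ennreal"
  where "envelope x = (INF u. energy x u)"

lemma energy_parallelogram:
  "energy (x + y) (u + v) + energy (x - y) (u - v) = 2 * energy x u + 2 * energy y v"
proof -
  have "ennreal ((norm (u + v - (x + y)))\<^sup>2) + ennreal ((norm (u - v - (x - y)))\<^sup>2)
      = ennreal (2 * (norm (u - x))\<^sup>2 + 2 * (norm (v - y))\<^sup>2)"
    using norm_parallelogram[of "u - x" "v - y"]
    by (simp add: ennreal_plus[symmetric] algebra_simps del: ennreal_plus)
  also have "\<dots> = 2 * ennreal ((norm (u - x))\<^sup>2) + 2 * ennreal ((norm (v - y))\<^sup>2)"
    by (simp add: ennreal_plus ennreal_mult)
  finally have norms: "ennreal ((norm (u + v - (x + y)))\<^sup>2) + ennreal ((norm (u - v - (x - y)))\<^sup>2)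
      = 2 * ennreal ((norm (u - x))\<^sup>2) + 2 * ennreal ((norm (v - y))\<^sup>2)" .
  have "energy (x + y) (u + v) + energy (x - y) (u - v)
      = (ennreal ((norm (u + v - (x + y)))\<^sup>2) + ennreal ((norm (u - v - (x - y)))\<^sup>2))
        + (Q (u + v) + Q (u - v))"
    unfolding energy_def by (simp only: add_ac)
  then show ?thesis
    unfolding norms parallelogram energy_def by (simp only: distrib_left add_ac)
qed

lemma energy_scaleC: "energy (c *\<^sub>C x) (c *\<^sub>C u) = ennreal ((cmod c)\<^sup>2) * energy x u"
  by (simp add: energy_def homogeneous scaleC_diff_right[symmetric] power_mult_distrib ennreal_mult
      distrib_left)

lemma envelope_le: "envelope x \<le> energy x u"
  unfolding envelope_def by (rule INF_lower) simp

lemma envelope_finite: "envelope x < \<infinity>"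
  by (rule le_less_trans[OF envelope_le[of x 0]]) (simp add: energy_def)

text \<open>Two points of small energy are close to each other, because their midpoint cannot beat the
  infimum.\<close>

lemma energy_gap:
  "ennreal ((norm (u - v))\<^sup>2) + 4 * envelope x \<le> 2 * energy x u + 2 * energy x v"
proof -
  have "energy (x + x) (u + v) = energy (2 *\<^sub>C x) (2 *\<^sub>C ((1/2) *\<^sub>C (u + v)))"
    using scaleC_add_left[of 1 1 x] by (simp add: scaleC_scaleC)
  also have "\<dots> = 4 * energy x ((1/2) *\<^sub>C (u + v))"
    unfolding energy_scaleC by simp
  finally have "4 * envelope x \<le> energy (x + x) (u + v)"
    by (metis envelope_le mult_left_mono zero_le)
  moreover have "ennreal ((norm (u - v))\<^sup>2) \<le> energy (x - x) (u - v)"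
    by (simp add: energy_def)
  ultimately show ?thesis
    using energy_parallelogram[of x x u v] by (metis add.commute add_mono)
qed

text \<open>
  By the gap estimate a minimizing sequence is Cauchy. Closed sublevel sets then bound \<open>Q\<close> at its
  limit.
\<close>

lemma minimizer_exists: "\<exists>u. energy x u \<le> envelope x"
proof -
  obtain m where m: "envelope x = ennreal m" "0 \<le> m"
    using envelope_finite[of x] by (cases "envelope x") auto
  have "\<exists>u. energy x u < ennreal (m + 1 / real (Suc n))" for n
  proof -
    have "envelope x < ennreal (m + 1 / real (Suc n))"
      using m by (simp add: ennreal_less_iff)
    then show ?thesis unfolding envelope_def INF_less_iff by blast
  qed
  then obtain w where w: "\<And>n. energy x (w n) < ennreal (m + 1 / real (Suc n))" by metis
  have gap: "(norm (w i - w j))\<^sup>2 \<le> 2 / real (Suc i) + 2 / real (Suc j)" for i j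
  proof -
    have "ennreal ((norm (w i - w j))\<^sup>2 + 4 * m) = ennreal ((norm (w i - w j))\<^sup>2) + 4 * envelope x"
      using m by (simp add: ennreal_plus ennreal_mult)
    also have "\<dots> \<le> 2 * energy x (w i) + 2 * energy x (w j)" by (rule energy_gap)
    also have "\<dots> \<le> 2 * ennreal (m + 1 / real (Suc i)) + 2 * ennreal (m + 1 / real (Suc j))"
      by (intro add_mono mult_left_mono less_imp_le w) auto
    also have "\<dots> = ennreal (2 * (m + 1 / real (Suc i)) + 2 * (m + 1 / real (Suc j)))"
    proof -
      have "0 \<le> m + 1 / real (Suc k)" for k using m by simp
      then show ?thesis
        by (simp only: ennreal_plus ennreal_mult mult_nonneg_nonneg zero_le_numeral ennreal_numeral)
    qed
    finally have "(norm (w i - w j))\<^sup>2 + 4 * m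
        \<le> 2 * (m + 1 / real (Suc i)) + 2 * (m + 1 / real (Suc j))"
      using m by (subst (asm) ennreal_le_iff) auto
    then show ?thesis by (simp add: algebra_simps)
  qed
  have "Cauchy w"
  proof (rule metric_CauchyI)
    fix e :: real assume e: "0 < e"
    obtain N where N: "4 / real (Suc N) < e\<^sup>2"
      using e reals_Archimedean[of "e\<^sup>2 / 4"] by (auto simp: field_simps)
    have "dist (w i) (w j) < e" if "i \<ge> N" "j \<ge> N" for i j
    proof -
      have "2 / real (Suc i) \<le> 2 / real (Suc N)" "2 / real (Suc j) \<le> 2 / real (Suc N)"
        using that by (auto intro!: divide_left_mono)
      then have "(norm (w i - w j))\<^sup>2 < e\<^sup>2" using gap[of i j] N by simp
      then show ?thesis using e by (simp add: dist_norm power2_less_imp_less)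
    qed
    then show "\<exists>M. \<forall>i\<ge>M. \<forall>j\<ge>M. dist (w i) (w j) < e" by blast
  qed
  then obtain u where u: "w \<longlonglongrightarrow> u" using Cauchy_convergent convergent_def by blast
  define a where "a = (norm (u - x))\<^sup>2"
  have lim: "(\<lambda>n. (norm (w n - x))\<^sup>2) \<longlonglongrightarrow> a"
    unfolding a_def by (intro tendsto_intros u)
  have "energy x u \<le> ennreal m + ennreal d" if d: "d > 0" for d
  proof -
    have "\<forall>\<^sub>F n in sequentially. (norm (w n - x))\<^sup>2 > a - d / 2"
      using order_tendstoD(1)[OF lim] d by simp
    moreover have "\<forall>\<^sub>F n in sequentially. 1 / real (Suc n) < d / 2"
      using order_tendstoD(2)[OF LIMSEQ_inverse_real_of_nat, of "d / 2"] d
      by (simp add: inverse_eq_divide)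
    ultimately have "\<forall>\<^sub>F n in sequentially. 0 \<le> m + d - a \<and> Q (w n) \<le> ennreal (m + d - a)"
    proof eventually_elim
      case (elim n)
      have "Q (w n) \<le> energy x (w n)" by (simp add: energy_def)
      also have "\<dots> < ennreal (m + 1 / real (Suc n))" by (rule w)
      also have "\<dots> < \<infinity>" by simp
      finally have "Q (w n) < \<infinity>" .
      then obtain q where q: "Q (w n) = ennreal q" "0 \<le> q" by (cases "Q (w n)") auto
      have "(norm (w n - x))\<^sup>2 + q < m + 1 / real (Suc n)"
        using w[of n] m q by (simp add: energy_def ennreal_plus[symmetric] ennreal_less_iff del: ennreal_plus)
      then show ?case using elim q by (auto intro!: ennreal_leI)
    qed
    then obtain N where N: "\<And>n. n \<ge> N \<Longrightarrow> 0 \<le> m + d - a \<and> Q (w n) \<le> ennreal (m + d - a)"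
      unfolding eventually_sequentially by blast
    have pos: "0 \<le> m + d - a" using N[of N] by simp
    have "Q u \<le> ennreal (m + d - a)"
      using closed_sequentially[OF closed_sublevel _ LIMSEQ_ignore_initial_segment[OF u, of N],
          of "ennreal (m + d - a)"] N[OF le_add2] by simp
    then have "energy x u \<le> ennreal a + ennreal (m + d - a)"
      unfolding energy_def a_def by (rule add_left_mono)
    also have "\<dots> = ennreal (a + (m + d - a))"
      by (rule ennreal_plus[symmetric]) (use pos in \<open>simp_all add: a_def\<close>)
    also have "\<dots> = ennreal m + ennreal d"
      using m d by (simp add: ennreal_plus)
    finally show ?thesis .
  qed
  then have "energy x u \<le> ennreal m"
    by (rule ennreal_le_epsilon)
  then show ?thesis using m by auto
qed

definition prox :: "'h \<Rightarrow> 'h"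
  where "prox x = (SOME u. energy x u \<le> envelope x)"

lemma energy_prox: "energy x (prox x) = envelope x"
  using someI_ex[OF minimizer_exists[of x]] envelope_le unfolding prox_def
  by (metis order_antisym)

lemma prox_eqI:
  assumes "energy x u \<le> envelope x"
  shows "prox x = u"
proof -
  have "ennreal ((norm (prox x - u))\<^sup>2) + 4 * envelope x \<le> 2 * envelope x + 2 * envelope x"
    using energy_gap[of "prox x" u x] assms energy_prox[of x] by (metis envelope_le order_antisym)
  also have "\<dots> = 0 + 4 * envelope x" by (simp add: distrib_right[symmetric])
  finally have "ennreal ((norm (prox x - u))\<^sup>2) \<le> 0"
    using envelope_finite[of x] by (auto simp: ennreal_mult_eq_top_iff ennreal_add_left_cancel_le)
  then show ?thesis by simp
qed


text \<open>Additivity comes from uniqueness of the minimizer: the parallelogram law of the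
  energy makes \<open>prox x + prox y\<close> a minimizer for \<open>x + y\<close>.\<close>

lemma prox_add: "prox (x + y) = prox x + prox y"
proof (rule prox_eqI)
  define e where "e z = enn2real (envelope z)" for z
  have e: "envelope z = ennreal (e z)" "0 \<le> e z" for z
    using envelope_finite[of z] by (simp_all add: e_def)
  have quadruple: "4 * envelope z \<le> envelope (z + z)" for z
  proof -
    have "z + z = 2 *\<^sub>C z" using scaleC_add_left[of 1 1 z] by simp
    then have "energy (z + z) (2 *\<^sub>C ((1/2) *\<^sub>C prox (z + z))) = 4 * energy z ((1/2) *\<^sub>C prox (z + z))"
      using energy_scaleC[of 2 z "(1/2) *\<^sub>C prox (z + z)"] by simp
    then show ?thesis
      using mult_left_mono[OF envelope_le[of z "(1/2) *\<^sub>C prox (z + z)"], of 4]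
      by (simp add: scaleC_scaleC energy_prox)
  qed
  have "4 * envelope x + 4 * envelope y \<le> envelope (x + x) + envelope (y + y)"
    by (rule add_mono[OF quadruple quadruple])
  also have "\<dots> \<le> energy (x + y + (x - y)) (prox (x + y) + prox (x - y))
      + energy (x + y - (x - y)) (prox (x + y) - prox (x - y))"
    by (intro add_mono) (simp_all add: envelope_le)
  also have "\<dots> = 2 * envelope (x + y) + 2 * envelope (x - y)"
    unfolding energy_parallelogram by (simp add: energy_prox)
  finally have "ennreal (4 * e x + 4 * e y) \<le> ennreal (2 * e (x + y) + 2 * e (x - y))"
    by (simp add: e ennreal_plus ennreal_mult)
  then have le: "2 * e x + 2 * e y \<le> e (x + y) + e (x - y)"
    using e(2)[of "x + y"] e(2)[of "x - y"] by (subst (asm) ennreal_le_iff) auto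
  have "envelope (x - y) + energy (x + y) (prox x + prox y)
      \<le> energy (x - y) (prox x - prox y) + energy (x + y) (prox x + prox y)"
    by (intro add_right_mono envelope_le)
  also have "\<dots> = 2 * envelope x + 2 * envelope y"
    using energy_parallelogram[of x y "prox x" "prox y"] by (simp add: energy_prox add.commute)
  also have "\<dots> = ennreal (2 * e x + 2 * e y)"
    by (simp add: e ennreal_plus ennreal_mult)
  also have "\<dots> \<le> ennreal (e (x + y) + e (x - y))" using le by (rule ennreal_leI)
  also have "\<dots> = envelope (x - y) + envelope (x + y)"
    by (simp add: e ennreal_plus add.commute)
  finally show "energy (x + y) (prox x + prox y) \<le> envelope (x + y)"
    using envelope_finite[of "x - y"] by (auto simp: ennreal_add_left_cancel_le)
qed

lemma prox_zero [simp]: "prox 0 = 0"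
  by (rule prox_eqI) (simp add: energy_def)

lemma prox_scaleC: "prox (c *\<^sub>C x) = c *\<^sub>C prox x"
proof (cases "c = 0")
  case False
  show ?thesis
  proof (rule prox_eqI)
    have "energy (c *\<^sub>C x) (c *\<^sub>C prox x) = ennreal ((cmod c)\<^sup>2) * envelope x"
      by (simp add: energy_scaleC energy_prox)
    also have "\<dots> \<le> ennreal ((cmod c)\<^sup>2) * energy x ((1 / c) *\<^sub>C prox (c *\<^sub>C x))"
      by (intro mult_left_mono envelope_le) simp
    also have "\<dots> = energy (c *\<^sub>C x) (prox (c *\<^sub>C x))"
      using False by (simp add: energy_scaleC[symmetric] scaleC_scaleC)
    finally show "energy (c *\<^sub>C x) (c *\<^sub>C prox x) \<le> envelope (c *\<^sub>C x)"
      by (simp add: energy_prox)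
  qed
qed simp

lemma prox_sq_le: "(norm (prox x - x))\<^sup>2 \<le> (norm x)\<^sup>2"
proof -
  have "ennreal ((norm (prox x - x))\<^sup>2) \<le> envelope x"
    by (simp add: energy_prox[symmetric] energy_def)
  also have "\<dots> \<le> ennreal ((norm x)\<^sup>2)" using envelope_le[of x 0] by (simp add: energy_def)
  finally show ?thesis by (simp add: ennreal_le_iff)
qed

lemma bounded_linear_prox: "bounded_linear prox"
proof (rule bounded_linear_intro[where K = 2])
  show "norm (prox x) \<le> norm x * 2" for x
  proof -
    have "norm (prox x - x) \<le> norm x" using prox_sq_le[of x] by simp
    then show ?thesis using norm_triangle_ineq[of "prox x - x" x] by simp
  qed
qed (simp_all add: prox_add scaleR_scaleC prox_scaleC)

lemma Q_prox_finite: "Q (prox x) < \<infinity>"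
proof -
  have "Q (prox x) \<le> envelope x" by (simp add: energy_prox[symmetric] energy_def)
  then show ?thesis using envelope_finite[of x] by (rule le_less_trans)
qed

text \<open>Turning \<open>prox x\<close> by a phase leaves its \<open>Q\<close>-value unchanged, so by minimality \<open>\<langle>prox x, x\<rangle>\<close>
  has the optimal phase.\<close>

lemma cinner_prox_real: "cinner (prox x) x = complex_of_real (cmod (cinner (prox x) x))"
proof (cases "cinner (prox x) x = 0")
  case False
  let ?z = "cinner (prox x) x"
  \<comment> \<open>the phase that rotates \<open>?z\<close> onto the positive axis\<close>
  define c where "c = cnj ?z / complex_of_real (cmod ?z)"
  have c1: "cmod c = 1" using False by (simp add: c_def norm_divide)
  have cz: "c * ?z = complex_of_real (cmod ?z)"
    using False by (simp add: c_def mult.commute[of "cnj ?z"] power2_eq_square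
        flip: complex_norm_square)
  obtain q where q: "Q (prox x) = ennreal q" "0 \<le> q"
    using Q_prox_finite[of x] by (cases "Q (prox x)") auto
  have "energy x (prox x) \<le> energy x (c *\<^sub>C prox x)" by (simp add: energy_prox envelope_le)
  then have "(norm (prox x - x))\<^sup>2 + q \<le> (norm (c *\<^sub>C prox x - x))\<^sup>2 + q"
    using q by (simp add: energy_def homogeneous c1 ennreal_le_iff flip: ennreal_plus)
  then have "Re (c * ?z) \<le> Re ?z"
    by (simp add: norm_diff_sq c1 cinner_scaleC_left)
  then have "cmod ?z \<le> Re ?z" unfolding cz by simp
  then have "Re ?z = cmod ?z" using complex_Re_le_cmod[of ?z] by linarith
  then show ?thesis
    using cmod_power2[of ?z] by (simp add: complex_eq_iff)
qed simp

lemma prox_selfadjoint: "cinner (prox x) y = cinner x (prox y)"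
proof -
  have "cinner (prox x) y - cinner x (prox y) = 0"
  proof (rule sesquilinear_zero_diagonal[where B = "\<lambda>x y. cinner (prox x) y - cinner x (prox y)"])
    fix x
    have "cinner x (prox x) = cnj (cinner (prox x) x)" by (rule cinner_commute)
    then show "cinner (prox x) x - cinner x (prox x) = 0"
      using cinner_prox_real[of x] by (metis complex_cnj_complex_of_real eq_iff_diff_eq_0)
  qed (simp_all add: prox_add prox_scaleC cinner_simps algebra_simps)
  then show ?thesis by simp
qed

lemma energy_scaleR:
  assumes "Q x = ennreal q" "0 \<le> q"
  shows "energy x (t *\<^sub>R x) = ennreal ((t - 1)\<^sup>2 * (norm x)\<^sup>2 + t\<^sup>2 * q)"
proof -
  have "t *\<^sub>R x - x = (t - 1) *\<^sub>R x" by (simp add: scaleR_left_diff_distrib)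
  then have "(norm (t *\<^sub>R x - x))\<^sup>2 = (t - 1)\<^sup>2 * (norm x)\<^sup>2"
    by (simp add: power_mult_distrib)
  moreover have "Q (t *\<^sub>R x) = ennreal (t\<^sup>2 * q)"
    using assms by (simp add: scaleR_scaleC homogeneous ennreal_mult)
  ultimately show ?thesis using assms by (simp add: energy_def)
qed

text \<open>First variation of the energy along the ray through \<open>x\<close>.\<close>

lemma Q_eq_of_prox_scaleR:
  assumes p: "prox x = t *\<^sub>R x" and q: "Q x = ennreal q" "0 \<le> q"
  shows "t * ((norm x)\<^sup>2 + q) = (norm x)\<^sup>2"
proof -
  have "(t - 1) * (norm x)\<^sup>2 + t * q = 0"
  proof (rule linear_coefficient_zero)
    fix s
    have "energy x (t *\<^sub>R x) \<le> energy x ((t + s) *\<^sub>R x)"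
      using energy_prox[of x] envelope_le[of x] by (simp add: p)
    then have "(t - 1)\<^sup>2 * (norm x)\<^sup>2 + t\<^sup>2 * q \<le> (t + s - 1)\<^sup>2 * (norm x)\<^sup>2 + (t + s)\<^sup>2 * q"
      using q(2) by (simp add: energy_scaleR[OF q] ennreal_le_iff del: ennreal_plus)
    then show "0 \<le> 2 * s * ((t - 1) * (norm x)\<^sup>2 + t * q) + s\<^sup>2 * ((norm x)\<^sup>2 + q)"
      by (simp add: power2_eq_square algebra_simps)
  qed
  then show ?thesis by (simp add: algebra_simps)
qed

lemma prox_unitary:
  assumes U: "unitary_operator U" and inv: "\<And>u. Q (U u) = Q u"
  shows "prox (U x) = U (prox x)"
proof (rule prox_eqI)
  interpret U: bounded_linear U by (rule unitary_bounded_linear[OF U])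
  have e: "energy (U y) (U u) = energy y u" for y u
    by (simp add: energy_def inv U.diff[symmetric] unitary_norm[OF U])
  obtain w where w: "prox (U x) = U w"
    using U unfolding unitary_operator_def surj_def by blast
  show "energy (U x) (U (prox x)) \<le> envelope (U x)"
    using envelope_le[of x w] energy_prox[of "U x"] by (simp add: e w energy_prox)
qed

text \<open>Schur's lemma for a possibly unbounded form: \<open>prox\<close> is a bounded self-adjoint intertwiner, hence
  a scalar \<open>t\<close>, and \<open>prox x = t x\<close> determines \<open>Q x\<close>.\<close>

theorem invariant_form_scalar:
  assumes irr: "irreducible_family P" and P: "\<And>U. U \<in> P \<Longrightarrow> unitary_operator U"
    and inv: "\<And>U u. U \<in> P \<Longrightarrow> Q (U u) = Q u"
    and z: "z \<noteq> 0" "Q z < \<infinity>"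
  shows "\<exists>c\<ge>0. \<forall>u. Q u = ennreal (c * (norm u)\<^sup>2)"
proof -
  have "\<exists>t::real. \<forall>x. prox x = t *\<^sub>R x"
    using irr unitary_bounded_linear[OF P] bounded_linear_prox prox_selfadjoint prox_scaleC
  proof (rule selfadjoint_intertwiner_scalar)
    show "prox (U x) = U (prox x)" if "U \<in> P" for U x
      by (rule prox_unitary[OF P[OF that] inv[OF that]])
  qed
  then obtain t where t: "\<And>x. prox x = t *\<^sub>R x" by blast
  obtain q where q: "Q z = ennreal q" "0 \<le> q" using z(2) by (cases "Q z") auto
  have tz: "t * ((norm z)\<^sup>2 + q) = (norm z)\<^sup>2" by (rule Q_eq_of_prox_scaleR[OF t q])
  have z0: "(norm z)\<^sup>2 > 0" using z(1) by simp
  then have t0: "t \<noteq> 0" using tz by auto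
  have "t > 0"
    using tz z0 q(2) by (metis add_pos_nonneg zero_less_mult_pos2)
  have "t * (norm z)\<^sup>2 \<le> (norm z)\<^sup>2"
    using tz mult_nonneg_nonneg[OF less_imp_le[OF \<open>t > 0\<close>] q(2)] by (simp add: distrib_left)
  then have t1: "t \<le> 1" using z0 by simp
  show ?thesis
  proof (intro exI conjI allI)
    show "0 \<le> (1 - t) / t" using t1 \<open>t > 0\<close> by simp
    fix u
    have "Q (t *\<^sub>R u) < \<infinity>" using Q_prox_finite[of u] by (simp add: t)
    then have "Q u < \<infinity>"
      using t0 by (auto simp: scaleR_scaleC homogeneous ennreal_mult_less_top)
    then obtain r where r: "Q u = ennreal r" "0 \<le> r" by (cases "Q u") auto
    have "t * ((norm u)\<^sup>2 + r) = (norm u)\<^sup>2" by (rule Q_eq_of_prox_scaleR[OF t r])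
    then have "r = (1 - t) / t * (norm u)\<^sup>2"
      using t0 by (simp add: field_simps)
    then show "Q u = ennreal ((1 - t) / t * (norm u)\<^sup>2)" by (simp add: r)
  qed
qed

end

text \<open>
  For this form \<open>prox\<close> is the orthogonal projection onto \<open>M\<close>, so the existence of minimizers
  covers projections as well.
\<close>

lemma lsc_quadratic_form_indicator:
  assumes M: "closed_csubspace M"
  shows "lsc_quadratic_form (\<lambda>u::'h::complex_hilbert_space. if u \<in> M then 0 else \<infinity>)"
proof
  have add: "x + y \<in> M" and sc: "c *\<^sub>C x \<in> M" if "x \<in> M" "y \<in> M" for x y c
    using M that unfolding closed_csubspace_def by blast+
  have neg: "- x \<in> M" if "x \<in> M" for x using sc[OF that that, of "-1"] by (simp add: scaleC_minus_one)
  have diff: "x - y \<in> M" if "x \<in> M" "y \<in> M" for x y using add[OF that(1) neg[OF that(2)]] by simp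
  have M0: "0 \<in> M" using M unfolding closed_csubspace_def by blast
  fix u v :: 'h and c :: complex and K :: ennreal
  show "(if c *\<^sub>C u \<in> M then 0 else \<infinity>) = ennreal ((cmod c)\<^sup>2) * (if u \<in> M then 0 else \<infinity>)"
  proof (cases "c = 0 \<or> u \<in> M")
    case True
    then show ?thesis using sc M0 by auto
  next
    case False
    have "c *\<^sub>C u \<notin> M"
    proof
      assume "c *\<^sub>C u \<in> M"
      then have "(1 / c) *\<^sub>C c *\<^sub>C u \<in> M" using sc by blast
      then show False using False by (simp add: scaleC_scaleC)
    qed
    then show ?thesis using False by (simp add: ennreal_mult_top)
  qed
  have half: "x \<in> M" if "x + x \<in> M" for x
  proof -
    have "(1 / 2) *\<^sub>C (x + x) = x"
      using scaleC_add_left[of "1/2" "1/2" x] by (simp add: scaleC_add_right)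
    then show ?thesis using sc[OF that that, of "1 / 2"] by simp
  qed
  have "u \<in> M \<and> v \<in> M" if "u + v \<in> M" "u - v \<in> M"
  proof
    have "u + u \<in> M" using add[OF that] by simp
    then show "u \<in> M" by (rule half)
    have "v + v \<in> M" using diff[OF that] by simp
    then show "v \<in> M" by (rule half)
  qed
  then show "(if u + v \<in> M then 0 else \<infinity>) + (if u - v \<in> M then 0 else \<infinity>) =
      2 * (if u \<in> M then 0 else \<infinity>) + 2 * (if v \<in> M then 0 else (\<infinity>::ennreal))"
    using add[of u v] diff[of u v] by (auto simp: ennreal_mult_top)
  have "{u. (if u \<in> M then 0 else \<infinity>) \<le> K} = (if K = \<infinity> then UNIV else M)"
    by (auto simp: top_unique)
  then show "closed {u. (if u \<in> M then 0 else \<infinity>) \<le> K}"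
    using M unfolding closed_csubspace_def by simp
qed

text \<open>
  The residual \<open>z = a - prox a\<close> of a vector outside the kernel \<open>M\<close> is orthogonal to \<open>M\<close>, and
  \<open>f z x - f x z\<close> lies in \<open>M\<close>.
\<close>

lemma riesz_representation:
  fixes f :: "'h::complex_hilbert_space \<Rightarrow> complex"
  assumes f: "bounded_linear f" and fC: "\<And>c x. f (c *\<^sub>C x) = c * f x"
  shows "\<exists>v. \<forall>x. f x = cinner x v"
proof (cases "\<forall>x. f x = 0")
  case True
  then show ?thesis by (intro exI[of _ 0]) simp
next
  case False
  then obtain a where a: "f a \<noteq> 0" by blast
  interpret f: bounded_linear f by fact
  define M where "M = {x. f x = 0}"
  have in_M: "x \<in> M \<longleftrightarrow> f x = 0" for x by (simp add: M_def)
  have M: "closed_csubspace M"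
  proof -
    have "closed {x. f x = 0}"
      by (intro closed_Collect_eq continuous_on_const linear_continuous_on[OF f])
    then show ?thesis by (simp add: closed_csubspace_def M_def f.zero f.add fC)
  qed
  interpret lsc_quadratic_form "\<lambda>u. if u \<in> M then 0 else \<infinity>"
    by (rule lsc_quadratic_form_indicator[OF M])
  define p where "p = prox a"
  define z where "z = a - p"
  have fp: "f p = 0"
  proof -
    have "prox a \<in> M"
    proof (rule ccontr)
      assume "prox a \<notin> M"
      with Q_prox_finite[of a] show False by simp
    qed
    then show ?thesis by (simp only: in_M p_def)
  qed
  have fz: "f z = f a" by (simp add: z_def f.diff fp)
  have orth: "Re (cinner w z) = 0" if w: "f w = 0" for w
  proof (rule linear_coefficient_zero)
    fix t
    have mem: "p \<in> M" "p - t *\<^sub>R w \<in> M"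
      using w by (simp_all add: in_M fp f.diff f.scaleR)
    have "energy a (p) \<le> energy a (p - t *\<^sub>R w)"
      unfolding p_def energy_prox by (rule envelope_le)
    then have "(norm (p - a))\<^sup>2 \<le> (norm (p - t *\<^sub>R w - a))\<^sup>2"
      by (simp add: energy_def mem ennreal_le_iff)
    moreover have "p - a = - z" "p - t *\<^sub>R w - a = - (z + t *\<^sub>R w)"
      by (simp_all add: z_def)
    ultimately have "(norm z)\<^sup>2 \<le> (norm (z + t *\<^sub>R w))\<^sup>2" by (simp only: norm_minus_cancel)
    also have "\<dots> = (norm z)\<^sup>2 + 2 * t * Re (cinner w z) + t\<^sup>2 * (norm w)\<^sup>2"
      by (simp add: norm_add_sq cinner_scaleR_right Re_cinner_commute[of z w] power_mult_distrib)
    finally show "0 \<le> 2 * t * Re (cinner w z) + t\<^sup>2 * (norm w)\<^sup>2" by simp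
  qed
  have orthC: "cinner w z = 0" if w: "f w = 0" for w
  proof -
    have "Re (\<i> * cinner w z) = 0" using orth[of "\<i> *\<^sub>C w"] w by (simp add: fC cinner_scaleC_left)
    then show ?thesis using orth[OF w] by (simp add: complex_eq_iff)
  qed
  have z0: "z \<noteq> 0" using fz a f.zero by auto
  define n where "n = (norm z)\<^sup>2"
  have n: "n \<noteq> 0" "cinner z z = complex_of_real n" using z0 by (simp_all add: n_def cinner_self)
  show ?thesis
  proof (intro exI allI)
    fix x
    have "f (f z *\<^sub>C x - f x *\<^sub>C z) = 0" by (simp add: f.diff fC)
    then have "f z * cinner x z = f x * complex_of_real n"
      using orthC[of "f z *\<^sub>C x - f x *\<^sub>C z"] by (simp add: cinner_simps n)
    then show "f x = cinner x (cnj (f z / complex_of_real n) *\<^sub>C z)"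
      using n by (simp add: cinner_scaleC_right field_simps)
  qed
qed

section \<open>Orthogonality relations for covariant families\<close>

definition square_integrable :: "'a measure \<Rightarrow> ('a \<Rightarrow> complex) \<Rightarrow> bool"
  where "square_integrable M f \<longleftrightarrow>
    f \<in> borel_measurable M \<and> integrable M (\<lambda>x. (cmod (f x))\<^sup>2)"

lemma square_integrable_mult:
  assumes "square_integrable M f" "square_integrable M g"
  shows "integrable M (\<lambda>x. cmod (f x) * cmod (g x))"
    and "integrable M (\<lambda>x. f x * cnj (g x))"
proof -
  have [measurable]: "f \<in> borel_measurable M" "g \<in> borel_measurable M"
    using assms by (auto simp: square_integrable_def)
  have [measurable]: "cnj \<in> borel_measurable borel"
    by (intro borel_measurable_continuous_onI continuous_intros)
  have bound: "cmod (f x) * cmod (g x) \<le> (cmod (f x))\<^sup>2 + (cmod (g x))\<^sup>2" for x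
  proof -
    have "0 \<le> (cmod (f x) - cmod (g x))\<^sup>2 + (cmod (f x))\<^sup>2 + (cmod (g x))\<^sup>2" by simp
    then show ?thesis by (simp add: power2_diff)
  qed
  have I: "integrable M (\<lambda>x. (cmod (f x))\<^sup>2 + (cmod (g x))\<^sup>2)"
    using assms by (auto simp: square_integrable_def)
  show "integrable M (\<lambda>x. cmod (f x) * cmod (g x))"
    by (rule Bochner_Integration.integrable_bound[OF I]) (auto simp: bound)
  show "integrable M (\<lambda>x. f x * cnj (g x))"
    by (rule Bochner_Integration.integrable_bound[OF I]) (auto simp: norm_mult bound)
qed

lemma square_integrable_restrict:
  assumes "square_integrable M f" "A \<in> sets M"
  shows "square_integrable M (\<lambda>x. indicator A x *\<^sub>R f x)"
proof -
  have "(cmod (indicator A x *\<^sub>R f x))\<^sup>2 = indicator A x *\<^sub>R (cmod (f x))\<^sup>2" for x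
    by (simp split: split_indicator)
  then show ?thesis
    using assms unfolding square_integrable_def by (auto intro: integrable_mult_indicator simp del: norm_scaleR real_scaleR_def)
qed

text \<open>Discriminant of the nonnegative quadratic \<open>t \<mapsto> \<integral> (t \<bar>f\<bar> - \<bar>g\<bar>)\<^sup>2\<close>.\<close>

lemma integral_Cauchy_Schwarz:
  assumes f: "square_integrable M f" and g: "square_integrable M g"
  shows "(cmod (LINT x|M. f x * cnj (g x)))\<^sup>2
    \<le> (LINT x|M. (cmod (f x))\<^sup>2) * (LINT x|M. (cmod (g x))\<^sup>2)"
proof -
  define a p b where "a = (LINT x|M. (cmod (f x))\<^sup>2)"
    and "p = (LINT x|M. cmod (f x) * cmod (g x))" and "b = (LINT x|M. (cmod (g x))\<^sup>2)"
  have If: "integrable M (\<lambda>x. (cmod (f x))\<^sup>2)" and Ig: "integrable M (\<lambda>x. (cmod (g x))\<^sup>2)"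
    using f g by (auto simp: square_integrable_def)
  note Ifg = square_integrable_mult(1)[OF f g]
  have quad: "0 \<le> t\<^sup>2 * a - 2 * t * p + b" for t
  proof -
    have "0 \<le> (LINT x|M. (t * cmod (f x) - cmod (g x))\<^sup>2)" by simp
    also have "(LINT x|M. (t * cmod (f x) - cmod (g x))\<^sup>2)
        = (LINT x|M. t\<^sup>2 * (cmod (f x))\<^sup>2 - (2 * t) * (cmod (f x) * cmod (g x)) + (cmod (g x))\<^sup>2)"
      by (simp add: power2_diff power_mult_distrib algebra_simps)
    also have "\<dots> = t\<^sup>2 * a - 2 * t * p + b"
      unfolding a_def p_def b_def using If Ig Ifg
      by (subst Bochner_Integration.integral_add Bochner_Integration.integral_diff; simp)+
    finally show ?thesis .
  qed
  have pos: "0 \<le> a" "0 \<le> p" "0 \<le> b" by (simp_all add: a_def p_def b_def)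
  have "p\<^sup>2 \<le> a * b"
  proof (cases "a = 0")
    case True
    have "p = 0"
    proof (rule ccontr)
      assume p: "p \<noteq> 0"
      then show False using quad[of "(b + 1) / (2 * p)"] True by simp
    qed
    then show ?thesis using True by simp
  next
    case False
    then have a: "a > 0" using pos by simp
    have "0 \<le> (p / a)\<^sup>2 * a - 2 * (p / a) * p + b" by (rule quad)
    also have "\<dots> = b - p\<^sup>2 / a" using a by (simp add: power2_eq_square)
    finally show ?thesis using a by (simp add: pos_divide_le_eq mult.commute)
  qed
  moreover have "cmod (LINT x|M. f x * cnj (g x)) \<le> p"
    unfolding p_def using integral_norm_bound[of M "\<lambda>x. f x * cnj (g x)"] by (simp add: norm_mult)
  ultimately show ?thesis
    unfolding a_def[symmetric] b_def[symmetric] by (meson norm_ge_zero order_trans power_mono)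
qed

text \<open>
  This isolates what the representation contributes: the measure is preserved by maps that turn
  left multiplication by a value \<open>\<pi> x\<close> into a change of variables.
\<close>

locale irreducible_covariant_family =
  fixes \<nu> :: "'a measure" and \<pi> :: "'a \<Rightarrow> 'h::complex_hilbert_space \<Rightarrow> 'h"
  assumes unitary: "x \<in> space \<nu> \<Longrightarrow> unitary_operator (\<pi> x)"
    and measurable_coefficient [measurable]: "(\<lambda>x. cinner \<eta> (\<pi> x \<xi>)) \<in> borel_measurable \<nu>"
    and irreducible: "irreducible_family (\<pi> ` space \<nu>)"
    and covariant: "x \<in> space \<nu> \<Longrightarrow>
      \<exists>\<tau>\<in>\<nu> \<rightarrow>\<^sub>M \<nu>. distr \<nu> \<nu> \<tau> = \<nu> \<and> (\<forall>y\<in>space \<nu>. \<forall>\<xi>. \<pi> (\<tau> y) \<xi> = \<pi> x (\<pi> y \<xi>))"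
begin

definition coefficient_form :: "'h \<Rightarrow> 'h \<Rightarrow> ennreal"
  where "coefficient_form \<xi> \<eta> = (\<integral>\<^sup>+x. ennreal ((cmod (cinner \<eta> (\<pi> x \<xi>)))\<^sup>2) \<partial>\<nu>)"

text \<open>Fatou's lemma gives lower semicontinuity although the form need not be bounded a priori.\<close>

lemma lsc_coefficient_form: "lsc_quadratic_form (coefficient_form \<xi>)"
proof
  fix c :: complex and u v :: 'h and K :: ennreal
  show "coefficient_form \<xi> (c *\<^sub>C u) = ennreal ((cmod c)\<^sup>2) * coefficient_form \<xi> u"
    unfolding coefficient_form_def
    by (simp add: cinner_scaleC_left norm_mult power_mult_distrib ennreal_mult nn_integral_cmult)
  have pt: "ennreal ((cmod (a + b))\<^sup>2) + ennreal ((cmod (a - b))\<^sup>2)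
      = 2 * ennreal ((cmod a)\<^sup>2) + 2 * ennreal ((cmod b)\<^sup>2)" for a b
  proof -
    have "(cmod (a + b))\<^sup>2 + (cmod (a - b))\<^sup>2 = 2 * (cmod a)\<^sup>2 + 2 * (cmod b)\<^sup>2"
      by (rule norm_parallelogram)
    then have "ennreal ((cmod (a + b))\<^sup>2 + (cmod (a - b))\<^sup>2)
        = ennreal (2 * (cmod a)\<^sup>2 + 2 * (cmod b)\<^sup>2)" by simp
    then show ?thesis by (simp add: ennreal_plus ennreal_mult)
  qed
  show "coefficient_form \<xi> (u + v) + coefficient_form \<xi> (u - v)
      = 2 * coefficient_form \<xi> u + 2 * coefficient_form \<xi> v"
    unfolding coefficient_form_def cinner_add_left cinner_diff_left
    by (simp add: nn_integral_add[symmetric] nn_integral_cmult[symmetric] pt)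
  show "closed {u. coefficient_form \<xi> u \<le> K}"
    unfolding closed_sequential_limits
  proof (intro allI impI, elim conjE)
    fix w u assume w: "\<forall>n. w n \<in> {u. coefficient_form \<xi> u \<le> K}" and u: "w \<longlonglongrightarrow> u"
    have lim: "(\<lambda>n. ennreal ((cmod (cinner (w n) (\<pi> x \<xi>)))\<^sup>2))
        \<longlonglongrightarrow> ennreal ((cmod (cinner u (\<pi> x \<xi>)))\<^sup>2)" for x
      by (intro tendsto_ennrealI tendsto_intros u)
    have "coefficient_form \<xi> u
        = (\<integral>\<^sup>+x. liminf (\<lambda>n. ennreal ((cmod (cinner (w n) (\<pi> x \<xi>)))\<^sup>2)) \<partial>\<nu>)"
      unfolding coefficient_form_def
      by (intro nn_integral_cong lim_imp_Liminf[OF _ lim, symmetric]) simp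
    also have "\<dots> \<le> liminf (\<lambda>n. coefficient_form \<xi> (w n))"
      unfolding coefficient_form_def by (intro nn_integral_liminf) measurable
    also have "\<dots> \<le> liminf (\<lambda>n. K)" using w by (intro Liminf_mono) auto
    also have "\<dots> = K" by (simp add: Liminf_const)
    finally show "u \<in> {u. coefficient_form \<xi> u \<le> K}" by simp
  qed
qed

lemma coefficient_form_invariant:
  assumes x: "x \<in> space \<nu>"
  shows "coefficient_form \<xi> (\<pi> x \<eta>) = coefficient_form \<xi> \<eta>"
proof -
  obtain \<tau> where \<tau>[measurable]: "\<tau> \<in> \<nu> \<rightarrow>\<^sub>M \<nu>" and d: "distr \<nu> \<nu> \<tau> = \<nu>"
    and c: "\<And>y \<xi>. y \<in> space \<nu> \<Longrightarrow> \<pi> (\<tau> y) \<xi> = \<pi> x (\<pi> y \<xi>)"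
    using covariant[OF x] by blast
  have iso: "cinner (\<pi> x u) (\<pi> x v) = cinner u v" for u v
    using unitary[OF x] by (simp add: unitary_operator_def)
  have "coefficient_form \<xi> (\<pi> x \<eta>)
      = (\<integral>\<^sup>+y. ennreal ((cmod (cinner (\<pi> x \<eta>) (\<pi> y \<xi>)))\<^sup>2) \<partial>distr \<nu> \<nu> \<tau>)"
    by (simp add: coefficient_form_def d)
  also have "\<dots> = (\<integral>\<^sup>+y. ennreal ((cmod (cinner (\<pi> x \<eta>) (\<pi> (\<tau> y) \<xi>)))\<^sup>2) \<partial>\<nu>)"
    by (intro nn_integral_distr) measurable
  also have "\<dots> = coefficient_form \<xi> \<eta>"
    unfolding coefficient_form_def by (intro nn_integral_cong) (simp add: c iso)
  finally show ?thesis .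
qed

lemma coefficient_form_scalar:
  assumes "z \<noteq> 0" "coefficient_form \<xi> z < \<infinity>"
  shows "\<exists>c\<ge>0. \<forall>\<eta>. coefficient_form \<xi> \<eta> = ennreal (c * (norm \<eta>)\<^sup>2)"
proof (rule lsc_quadratic_form.invariant_form_scalar[OF lsc_coefficient_form irreducible])
  show "unitary_operator U" if "U \<in> \<pi> ` space \<nu>" for U
    using that unitary by blast
  show "coefficient_form \<xi> (U u) = coefficient_form \<xi> u" if "U \<in> \<pi> ` space \<nu>" for U u
    using that coefficient_form_invariant by blast
qed (rule assms)+

text \<open>
  In contrast to an admissible wavelet, \<open>0\<close> is included, so that these vectors are closed under the
  linear combinations that polarization uses.
\<close>

definition admissible :: "'h \<Rightarrow> bool"
  where "admissible \<xi> \<longleftrightarrow> (\<forall>\<eta>. coefficient_form \<xi> \<eta> < \<infinity>)"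

text \<open>By Schur's lemma a single nonzero vector with finite value decides finiteness everywhere.\<close>

lemma admissibleI:
  assumes "z \<noteq> 0" "coefficient_form \<xi> z < \<infinity>"
  shows "admissible \<xi>"
  using coefficient_form_scalar[OF assms] unfolding admissible_def by (metis ennreal_less_top infinity_ennreal_def)

lemma admissible_square_integrable:
  assumes "admissible \<xi>"
  shows "square_integrable \<nu> (\<lambda>x. cinner \<eta> (\<pi> x \<xi>))"
  using assms unfolding admissible_def coefficient_form_def square_integrable_def
  by (auto intro!: integrableI_nonneg)

lemma admissible_integral:
  assumes "admissible \<xi>"
  shows "\<exists>c\<ge>0. \<forall>\<eta>. (LINT x|\<nu>. (cmod (cinner \<eta> (\<pi> x \<xi>)))\<^sup>2) = c * (norm \<eta>)\<^sup>2"
proof -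
  have "\<exists>c\<ge>0. \<forall>\<eta>. coefficient_form \<xi> \<eta> = ennreal (c * (norm \<eta>)\<^sup>2)"
  proof (cases "\<exists>z::'h. z \<noteq> 0")
    case True
    then obtain z :: 'h where "z \<noteq> 0" by blast
    then show ?thesis
      using assms unfolding admissible_def by (intro coefficient_form_scalar) auto
  next
    case False
    then have "\<eta> = 0" for \<eta> :: 'h by blast
    have "coefficient_form \<xi> \<eta> = ennreal (0 * (norm \<eta>)\<^sup>2)" for \<eta>
      using lsc_quadratic_form.zero[OF lsc_coefficient_form, of \<xi>] \<open>\<And>\<eta>. \<eta> = (0::'h)\<close>[of \<eta>] by simp
    then show ?thesis by blast
  qed
  then obtain c where c: "c \<ge> 0" "\<And>\<eta>. coefficient_form \<xi> \<eta> = ennreal (c * (norm \<eta>)\<^sup>2)" by blast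
  have "(LINT x|\<nu>. (cmod (cinner \<eta> (\<pi> x \<xi>)))\<^sup>2) = c * (norm \<eta>)\<^sup>2" for \<eta>
    using c(1) c(2)[of \<eta>] unfolding coefficient_form_def
    by (intro integral_eq_nn_integral[THEN trans]) auto
  with c(1) show ?thesis by blast
qed

lemma admissible_add:
  assumes "admissible \<xi>\<^sub>1" "admissible \<xi>\<^sub>2"
  shows "admissible (\<xi>\<^sub>1 + a *\<^sub>C \<xi>\<^sub>2)"
  unfolding admissible_def
proof
  fix \<eta>
  let ?f = "\<lambda>x. cinner \<eta> (\<pi> x \<xi>\<^sub>1)" and ?g = "\<lambda>x. cnj a * cinner \<eta> (\<pi> x \<xi>\<^sub>2)"
  have "coefficient_form (\<xi>\<^sub>1 + a *\<^sub>C \<xi>\<^sub>2) \<eta>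
      \<le> (\<integral>\<^sup>+x. 2 * ennreal ((cmod (?f x))\<^sup>2)
          + ennreal (2 * (cmod a)\<^sup>2) * ennreal ((cmod (cinner \<eta> (\<pi> x \<xi>\<^sub>2)))\<^sup>2) \<partial>\<nu>)"
    unfolding coefficient_form_def
  proof (rule nn_integral_mono)
    fix x assume "x \<in> space \<nu>"
    then have "cinner \<eta> (\<pi> x (\<xi>\<^sub>1 + a *\<^sub>C \<xi>\<^sub>2)) = ?f x + ?g x"
      using unitary[of x] by (simp add: unitary_operator_def cinner_simps)
    moreover have "(cmod (?f x + ?g x))\<^sup>2 \<le> 2 * (cmod (?f x))\<^sup>2 + 2 * (cmod (?g x))\<^sup>2"
      using norm_parallelogram[of "?f x" "?g x"] zero_le_power2[of "cmod (?f x - ?g x)"] by linarith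
    ultimately have "(cmod (cinner \<eta> (\<pi> x (\<xi>\<^sub>1 + a *\<^sub>C \<xi>\<^sub>2))))\<^sup>2
        \<le> 2 * (cmod (?f x))\<^sup>2 + 2 * (cmod a)\<^sup>2 * (cmod (cinner \<eta> (\<pi> x \<xi>\<^sub>2)))\<^sup>2"
      by (simp add: norm_mult power_mult_distrib mult.assoc)
    then have "ennreal ((cmod (cinner \<eta> (\<pi> x (\<xi>\<^sub>1 + a *\<^sub>C \<xi>\<^sub>2))))\<^sup>2)
        \<le> ennreal (2 * (cmod (?f x))\<^sup>2 + 2 * (cmod a)\<^sup>2 * (cmod (cinner \<eta> (\<pi> x \<xi>\<^sub>2)))\<^sup>2)"
      by (rule ennreal_leI)
    also have "\<dots> = 2 * ennreal ((cmod (?f x))\<^sup>2)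
          + ennreal (2 * (cmod a)\<^sup>2) * ennreal ((cmod (cinner \<eta> (\<pi> x \<xi>\<^sub>2)))\<^sup>2)"
      by (simp add: ennreal_plus ennreal_mult)
    finally show "ennreal ((cmod (cinner \<eta> (\<pi> x (\<xi>\<^sub>1 + a *\<^sub>C \<xi>\<^sub>2))))\<^sup>2) \<le> \<dots>" .
  qed
  also have "\<dots> = 2 * coefficient_form \<xi>\<^sub>1 \<eta> + ennreal (2 * (cmod a)\<^sup>2) * coefficient_form \<xi>\<^sub>2 \<eta>"
    unfolding coefficient_form_def by (simp add: nn_integral_add nn_integral_cmult)
  also have "\<dots> < \<infinity>"
    using assms unfolding admissible_def by (simp add: ennreal_mult_less_top)
  finally show "coefficient_form (\<xi>\<^sub>1 + a *\<^sub>C \<xi>\<^sub>2) \<eta> < \<infinity>" .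
qed

text \<open>Polarization twice: in the analysing vectors it expresses the mixed integral through the scalar
  forms of the four vectors \<open>\<xi>\<^sub>1 + a \<xi>\<^sub>2\<close>, and in the analysed vectors it passes from the diagonal to
  all pairs.\<close>

theorem orthogonality_relations:
  assumes a1: "admissible \<xi>\<^sub>1" and a2: "admissible \<xi>\<^sub>2"
  shows "\<exists>c. \<forall>\<eta> \<zeta>. (LINT x|\<nu>. cinner \<eta> (\<pi> x \<xi>\<^sub>1) * cnj (cinner \<zeta> (\<pi> x \<xi>\<^sub>2))) = c * cinner \<eta> \<zeta>"
proof -
  define S where "S \<eta> \<zeta> = (LINT x|\<nu>. cinner \<eta> (\<pi> x \<xi>\<^sub>1) * cnj (cinner \<zeta> (\<pi> x \<xi>\<^sub>2)))" for \<eta> \<zeta>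
  note int = square_integrable_mult(2)[OF admissible_square_integrable[OF a1] admissible_square_integrable[OF a2]]
  have "\<exists>d. \<forall>\<eta>. (LINT x|\<nu>. (cmod (cinner \<eta> (\<pi> x (\<xi>\<^sub>1 + a *\<^sub>C \<xi>\<^sub>2))))\<^sup>2) = d * (norm \<eta>)\<^sup>2" for a
    using admissible_integral[OF admissible_add[OF a1 a2, of a]] by blast
  then obtain d where d: "\<And>a \<eta>. (LINT x|\<nu>. (cmod (cinner \<eta> (\<pi> x (\<xi>\<^sub>1 + a *\<^sub>C \<xi>\<^sub>2))))\<^sup>2) = d a * (norm \<eta>)\<^sup>2"
    by metis
  \<comment> \<open>The coefficients are conjugate-linear in the analysing vector, so \<open>\<xi>\<^sub>1 - \<i> \<xi>\<^sub>2\<close> carries \<open>+ \<i>\<close>.\<close>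
  define c where "c = (complex_of_real (d 1) - complex_of_real (d (-1))
      + \<i> * complex_of_real (d (-\<i>)) - \<i> * complex_of_real (d \<i>)) / 4"
  have diag: "S \<eta> \<eta> = c * cinner \<eta> \<eta>" for \<eta>
  proof -
    let ?q = "\<lambda>a x. complex_of_real ((cmod (cinner \<eta> (\<pi> x (\<xi>\<^sub>1 + a *\<^sub>C \<xi>\<^sub>2))))\<^sup>2)"
    have I: "integrable \<nu> (?q a)" for a
      using admissible_square_integrable[OF admissible_add[OF a1 a2, of a], of \<eta>]
      by (intro integrable_of_real) (simp add: square_integrable_def)
    have L: "(LINT x|\<nu>. ?q a x) = complex_of_real (d a) * cinner \<eta> \<eta>" for a
      using d[of \<eta> a] by (simp only: integral_complex_of_real of_real_mult cinner_self)
    have "S \<eta> \<eta> = (LINT x|\<nu>. (?q 1 x - ?q (-1) x + \<i> * ?q (-\<i>) x - \<i> * ?q \<i> x) / 4)"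
      unfolding S_def
    proof (rule Bochner_Integration.integral_cong[OF refl])
      fix x assume x: "x \<in> space \<nu>"
      have "?q a x = (cinner \<eta> (\<pi> x \<xi>\<^sub>1) + cnj a * cinner \<eta> (\<pi> x \<xi>\<^sub>2))
          * cnj (cinner \<eta> (\<pi> x \<xi>\<^sub>1) + cnj a * cinner \<eta> (\<pi> x \<xi>\<^sub>2))" for a
      proof -
        have "cinner \<eta> (\<pi> x (\<xi>\<^sub>1 + a *\<^sub>C \<xi>\<^sub>2)) = cinner \<eta> (\<pi> x \<xi>\<^sub>1) + cnj a * cinner \<eta> (\<pi> x \<xi>\<^sub>2)"
          using unitary[OF x] by (simp add: unitary_operator_def cinner_simps)
        then show ?thesis by (simp only: complex_norm_square)
      qed
      then show "cinner \<eta> (\<pi> x \<xi>\<^sub>1) * cnj (cinner \<eta> (\<pi> x \<xi>\<^sub>2))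
          = (?q 1 x - ?q (-1) x + \<i> * ?q (-\<i>) x - \<i> * ?q \<i> x) / 4"
        by (simp only:) (simp add: algebra_simps)
    qed
    also have "\<dots> = (complex_of_real (d 1) * cinner \<eta> \<eta> - complex_of_real (d (-1)) * cinner \<eta> \<eta>
        + \<i> * (complex_of_real (d (-\<i>)) * cinner \<eta> \<eta>) - \<i> * (complex_of_real (d \<i>) * cinner \<eta> \<eta>)) / 4" (is "_ = ?R")
    proof (rule has_bochner_integral_integral_eq)
      have "has_bochner_integral \<nu> (?q a) (complex_of_real (d a) * cinner \<eta> \<eta>)" for a
        using I L by (simp only: has_bochner_integral_iff)
      then show "has_bochner_integral \<nu> (\<lambda>x. (?q 1 x - ?q (-1) x + \<i> * ?q (-\<i>) x - \<i> * ?q \<i> x) / 4) ?R"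
        by (intro has_bochner_integral_divide_zero has_bochner_integral_diff has_bochner_integral_add
            has_bochner_integral_mult_right)
    qed
    also have "\<dots> = c * cinner \<eta> \<eta>"
      by (simp add: c_def algebra_simps)
    finally show ?thesis .
  qed
  have "S \<eta> \<zeta> - c * cinner \<eta> \<zeta> = 0" for \<eta> \<zeta>
  proof (rule sesquilinear_zero_diagonal[where B = "\<lambda>\<eta> \<zeta>. S \<eta> \<zeta> - c * cinner \<eta> \<zeta>"])
    fix x y z :: 'h and k :: complex
    show "S (x + y) z - c * cinner (x + y) z = S x z - c * cinner x z + (S y z - c * cinner y z)"
      by (simp add: S_def cinner_simps algebra_simps int)
    show "S x (y + z) - c * cinner x (y + z) = S x y - c * cinner x y + (S x z - c * cinner x z)"
      by (simp add: S_def cinner_simps algebra_simps int)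
    show "S (k *\<^sub>C x) y - c * cinner (k *\<^sub>C x) y = k * (S x y - c * cinner x y)"
      by (simp add: S_def cinner_simps algebra_simps)
    show "S x (k *\<^sub>C y) - c * cinner x (k *\<^sub>C y) = cnj k * (S x y - c * cinner x y)"
      by (simp add: S_def cinner_simps algebra_simps mult.left_commute)
    show "S x x - c * cinner x x = 0" by (simp add: diag)
  qed
  then show ?thesis unfolding S_def by (intro exI[of _ c]) simp
qed

text \<open>By Cauchy-Schwarz the weak integral is bounded as a functional, so it is given by a vector.\<close>

lemma partial_integral_exists:
  assumes a1: "admissible \<xi>\<^sub>1" and a2: "admissible \<xi>\<^sub>2" and A: "A \<in> sets \<nu>"
  shows "\<exists>v. has_weak_integral \<nu> A (\<lambda>x. cinner \<eta> (\<pi> x \<xi>\<^sub>1) *\<^sub>C \<pi> x \<xi>\<^sub>2) v"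
proof -
  let ?f = "\<lambda>x. indicator A x *\<^sub>R cinner \<eta> (\<pi> x \<xi>\<^sub>1)" and ?g = "\<lambda>\<zeta> x. cinner \<zeta> (\<pi> x \<xi>\<^sub>2)"
  have f: "square_integrable \<nu> ?f"
    by (rule square_integrable_restrict[OF admissible_square_integrable[OF a1] A])
  have g: "square_integrable \<nu> (?g \<zeta>)" for \<zeta> by (rule admissible_square_integrable[OF a2])
  define F where "F \<zeta> = (LINT x|\<nu>. ?g \<zeta> x * cnj (?f x))" for \<zeta>
  note int = square_integrable_mult(2)[OF g f]
  obtain c2 where c2: "c2 \<ge> 0" "\<And>\<zeta>. (LINT x|\<nu>. (cmod (?g \<zeta> x))\<^sup>2) = c2 * (norm \<zeta>)\<^sup>2"
    using admissible_integral[OF a2] by blast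
  have add: "F (x + y) = F x + F y" for x y
    unfolding F_def cinner_add_left distrib_right by (rule Bochner_Integration.integral_add[OF int int])
  have sc: "F (k *\<^sub>C x) = k * F x" for k x
    unfolding F_def cinner_scaleC_left mult.assoc by (rule integral_mult_right_zero)
  have scR: "F (r *\<^sub>R x) = r *\<^sub>R F x" for r x
    by (simp only: scaleR_scaleC[of r x] sc scaleR_conv_of_real)
  have "bounded_linear F"
  proof (rule bounded_linear_intro)
    fix \<zeta>
    let ?J = "LINT x|\<nu>. (cmod (?f x))\<^sup>2"
    have J: "0 \<le> c2 * ?J" using c2(1) by simp
    have "(cmod (F \<zeta>))\<^sup>2 \<le> (LINT x|\<nu>. (cmod (?g \<zeta> x))\<^sup>2) * ?J"
      unfolding F_def by (rule integral_Cauchy_Schwarz[OF g f])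
    also have "\<dots> = (norm \<zeta> * sqrt (c2 * ?J))\<^sup>2"
      unfolding c2(2) power_mult_distrib real_sqrt_pow2[OF J] by (simp only: mult_ac)
    finally show "norm (F \<zeta>) \<le> norm \<zeta> * sqrt (c2 * ?J)"
      by (rule power2_le_imp_le) (use J in simp)
  qed (simp_all only: add scR)
  then obtain v where v: "\<And>\<zeta>. F \<zeta> = cinner \<zeta> v" using riesz_representation[of F] sc by blast
  have eq: "indicator A x *\<^sub>R cinner (cinner \<eta> (\<pi> x \<xi>\<^sub>1) *\<^sub>C \<pi> x \<xi>\<^sub>2) \<zeta> = cnj (?g \<zeta> x * cnj (?f x))" for x \<zeta>
    using cinner_commute[of "\<pi> x \<xi>\<^sub>2" \<zeta>] by (simp add: cinner_scaleC_left split: split_indicator)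
  have "has_weak_integral \<nu> A (\<lambda>x. cinner \<eta> (\<pi> x \<xi>\<^sub>1) *\<^sub>C \<pi> x \<xi>\<^sub>2) v"
    unfolding has_weak_integral_def set_integrable_def set_lebesgue_integral_def eq
  proof (intro allI conjI)
    fix \<zeta>
    show "integrable \<nu> (\<lambda>x. cnj (?g \<zeta> x * cnj (?f x)))"
      using int[of \<zeta>] by (simp only: complex_integrable_cnj)
    show "cinner v \<zeta> = (LINT x|\<nu>. cnj (?g \<zeta> x * cnj (?f x)))"
      by (simp only: Bochner_Integration.integral_cnj F_def[symmetric] v cinner_commute[of v \<zeta>])
  qed
  then show ?thesis by blast
qed

text \<open>
  By the orthogonality relations the error \<open>w\<close>, paired with itself, is the integral over the
  complement of \<open>A\<close>. Cauchy-Schwarz bounds it by the omitted coefficients of \<open>\<eta>\<close> times a multiple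
  of \<open>\<parallel>w\<parallel>\<close>.
\<close>

lemma partial_integral_error:
  assumes a1: "admissible \<xi>\<^sub>1" and a2: "admissible \<xi>\<^sub>2" and A: "A \<in> sets \<nu>"
    and c: "\<And>\<eta> \<zeta>. (LINT x|\<nu>. cinner \<eta> (\<pi> x \<xi>\<^sub>1) * cnj (cinner \<zeta> (\<pi> x \<xi>\<^sub>2))) = c * cinner \<eta> \<zeta>"
    and c2: "c2 \<ge> 0" "\<And>\<zeta>. (LINT x|\<nu>. (cmod (cinner \<zeta> (\<pi> x \<xi>\<^sub>2)))\<^sup>2) = c2 * (norm \<zeta>)\<^sup>2"
    and v: "has_weak_integral \<nu> A (\<lambda>x. cinner \<eta> (\<pi> x \<xi>\<^sub>1) *\<^sub>C \<pi> x \<xi>\<^sub>2) v"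
  shows "(norm (c *\<^sub>C \<eta> - v))\<^sup>2 \<le> c2 * (LINT x:space \<nu> - A|\<nu>. (cmod (cinner \<eta> (\<pi> x \<xi>\<^sub>1)))\<^sup>2)"
proof -
  define w where "w = c *\<^sub>C \<eta> - v"
  let ?f = "\<lambda>x. cinner \<eta> (\<pi> x \<xi>\<^sub>1)" and ?g = "\<lambda>x. cinner w (\<pi> x \<xi>\<^sub>2)" and ?B = "space \<nu> - A"
  have f: "square_integrable \<nu> ?f" by (rule admissible_square_integrable[OF a1])
  have g: "square_integrable \<nu> ?g" by (rule admissible_square_integrable[OF a2])
  have B: "?B \<in> sets \<nu>" using A by auto
  have fB: "square_integrable \<nu> (\<lambda>x. indicator ?B x *\<^sub>R ?f x)"
    by (rule square_integrable_restrict[OF f B])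
  have swap: "cinner (?f x *\<^sub>C \<pi> x \<xi>\<^sub>2) w = ?f x * cnj (?g x)" for x
    using cinner_commute[of "\<pi> x \<xi>\<^sub>2" w] by (simp add: cinner_scaleC_left)
  have iv: "integrable \<nu> (\<lambda>x. indicator A x *\<^sub>R (?f x * cnj (?g x)))"
    and cv: "cinner v w = (LINT x|\<nu>. indicator A x *\<^sub>R (?f x * cnj (?g x)))"
    using v unfolding has_weak_integral_def set_integrable_def set_lebesgue_integral_def swap[symmetric]
    by blast+
  have "complex_of_real ((norm w)\<^sup>2) = c * cinner \<eta> w - cinner v w"
    unfolding cinner_self[symmetric] by (simp add: w_def cinner_diff_left cinner_scaleC_left)
  also have "\<dots> = (LINT x|\<nu>. ?f x * cnj (?g x) - indicator A x *\<^sub>R (?f x * cnj (?g x)))"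
    unfolding c[symmetric] cv
    by (rule Bochner_Integration.integral_diff[symmetric, OF square_integrable_mult(2)[OF f g] iv])
  also have "\<dots> = (LINT x|\<nu>. indicator ?B x *\<^sub>R ?f x * cnj (?g x))"
    by (rule Bochner_Integration.integral_cong) (auto split: split_indicator)
  finally have eq: "complex_of_real ((norm w)\<^sup>2) = (LINT x|\<nu>. indicator ?B x *\<^sub>R ?f x * cnj (?g x))" .
  define t where "t = (LINT x:?B|\<nu>. (cmod (?f x))\<^sup>2)"
  have t: "(LINT x|\<nu>. (cmod (indicator ?B x *\<^sub>R ?f x))\<^sup>2) = t"
    unfolding t_def set_lebesgue_integral_def
    by (rule Bochner_Integration.integral_cong) (auto split: split_indicator)
  have "((norm w)\<^sup>2)\<^sup>2 = (cmod (complex_of_real ((norm w)\<^sup>2)))\<^sup>2" by (simp only: norm_of_real power2_abs)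
  also have "\<dots> \<le> t * (c2 * (norm w)\<^sup>2)"
    unfolding eq using integral_Cauchy_Schwarz[OF fB g] by (simp only: t c2(2))
  finally have "(norm w)\<^sup>2 * (norm w)\<^sup>2 \<le> (c2 * t) * (norm w)\<^sup>2"
    by (simp add: power2_eq_square[of "(norm w)\<^sup>2"] mult_ac)
  moreover have "0 \<le> t"
    unfolding t[symmetric] by simp
  ultimately have "(norm w)\<^sup>2 \<le> c2 * t"
    using c2(1) mult_right_le_imp_le[of "(norm w)\<^sup>2" "(norm w)\<^sup>2" "c2 * t"] by (cases "w = 0") simp_all
  then show ?thesis by (simp add: w_def t_def)
qed

end

section \<open>The homogeneous space as a measure space with a transitive action\<close>

locale homogeneous_space = locally_compact_group G T
  for G :: "('g, 'm) monoid_scheme" (structure) and T :: "'g topology" +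
  fixes H :: "'g set"
  assumes subgroup_H: "subgroup H G" and closed_H: "closedin T H"
begin

abbreviation "X \<equiv> coset_topology G T H"

lemma H_subset: "H \<subseteq> carrier G"
  using subgroup_H by (rule subgroup.subset)

lemma coset_in: "g \<in> carrier G \<Longrightarrow> g <# H \<in> lcosets H"
  by (auto simp: LCOSETS_def)

lemma coset_cases:
  assumes "x \<in> lcosets H" obtains g where "g \<in> carrier G" "x = g <# H"
  using assms by (auto simp: LCOSETS_def)

lemma topspace_X: "topspace X = lcosets H"
  using quotient_map_coset_topology[of H, THEN quotient_imp_surjective_map]
  by (auto simp: topspace_eq_carrier LCOSETS_def)

lemma translate_coset:
  "s \<in> carrier G \<Longrightarrow> g \<in> carrier G \<Longrightarrow> s <# (g <# H) = (s \<otimes> g) <# H"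
  by (rule lcos_m_assoc[OF H_subset])

lemma coset_eq_iff:
  assumes "a \<in> carrier G" "b \<in> carrier G"
  shows "a <# H = b <# H \<longleftrightarrow> (\<exists>h\<in>H. a \<otimes> h = b)"
proof
  assume "a <# H = b <# H"
  then have "b \<in> a <# H" using lcos_self[OF assms(2) subgroup_H] by simp
  then show "\<exists>h\<in>H. a \<otimes> h = b" by (auto simp: l_coset_def)
next
  assume "\<exists>h\<in>H. a \<otimes> h = b"
  then have "b \<in> a <# H" by (auto simp: l_coset_def)
  then show "a <# H = b <# H" using l_repr_independence[OF _ assms(1) subgroup_H] by blast
qed

lemma open_map_coset:
  assumes U: "openin T U"
  shows "openin X ((\<lambda>g. g <# H) ` U)"
proof -
  have UG: "U \<subseteq> carrier G" using openin_subset[OF U] by (simp add: topspace_eq_carrier)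
  have "openin T {g \<in> topspace T. g \<otimes> h \<in> U}" if h: "h \<in> H" for h
  proof -
    have "continuous_map T (prod_topology T T) (\<lambda>g. (g, h))"
      using h H_subset by (intro continuous_map_pairedI) (auto simp: topspace_eq_carrier)
    then have "continuous_map T T ((\<lambda>(x, y). x \<otimes> y) \<circ> (\<lambda>g. (g, h)))"
      using continuous_mult by (rule continuous_map_compose)
    then show ?thesis using openin_continuous_map_preimage[OF _ U] by (fastforce simp: o_def)
  qed
  then have "openin T (\<Union>h\<in>H. {g \<in> topspace T. g \<otimes> h \<in> U})" by blast
  moreover have "{g \<in> topspace T. g <# H \<in> (\<lambda>g. g <# H) ` U} = (\<Union>h\<in>H. {g \<in> topspace T. g \<otimes> h \<in> U})"
  proof -
    have "g <# H \<in> (\<lambda>g. g <# H) ` U \<longleftrightarrow> (\<exists>h\<in>H. g \<otimes> h \<in> U)" if g: "g \<in> carrier G" for g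
    proof -
      have "g <# H \<in> (\<lambda>g. g <# H) ` U \<longleftrightarrow> (\<exists>u\<in>U. g <# H = u <# H)" by blast
      also have "\<dots> \<longleftrightarrow> (\<exists>u\<in>U. \<exists>h\<in>H. g \<otimes> h = u)"
        using UG coset_eq_iff[OF g] by blast
      finally show ?thesis by blast
    qed
    then show ?thesis unfolding topspace_eq_carrier by blast
  qed
  ultimately show ?thesis
    unfolding openin_coset_topology using UG coset_in by auto
qed

text \<open>Closedness of \<open>H\<close> makes \<open>inv x \<otimes> y \<notin> H\<close> an open condition on pairs, and the open quotient
  map carries a product neighbourhood to separating neighbourhoods.\<close>

lemma Hausdorff_X: "Hausdorff_space X"
  unfolding Hausdorff_space_def
proof (intro allI impI)
  fix x y assume "x \<in> topspace X \<and> y \<in> topspace X \<and> x \<noteq> y"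
  then obtain a b where a: "a \<in> carrier G" "x = a <# H" and b: "b \<in> carrier G" "y = b <# H"
    and ne: "a <# H \<noteq> b <# H"
    unfolding topspace_X by (metis coset_cases)
  let ?d = "\<lambda>p. inv (fst p) \<otimes> snd p"
  have "continuous_map (prod_topology T T) T (\<lambda>p. inv (fst p))"
    using continuous_map_compose[OF continuous_map_fst continuous_inv] by (simp add: o_def)
  then have "continuous_map (prod_topology T T) (prod_topology T T) (\<lambda>p. (inv (fst p), snd p))"
    by (intro continuous_map_pairedI continuous_map_snd)
  from continuous_map_compose[OF this continuous_mult]
  have d: "continuous_map (prod_topology T T) T ?d" by (simp add: o_def)
  define W where "W = {p \<in> topspace (prod_topology T T). ?d p \<in> topspace T - H}"
  have W: "openin (prod_topology T T) W"
    unfolding W_def using closed_H by (intro openin_continuous_map_preimage[OF d]) blast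
  have notH: "inv u \<otimes> v \<notin> H \<longleftrightarrow> u <# H \<noteq> v <# H" if u: "u \<in> carrier G" and v: "v \<in> carrier G" for u v
  proof -
    have "(\<exists>h\<in>H. u \<otimes> h = v) \<longleftrightarrow> inv u \<otimes> v \<in> H"
    proof
      assume "\<exists>h\<in>H. u \<otimes> h = v"
      then obtain h where h: "h \<in> H" "v = u \<otimes> h" by blast
      then show "inv u \<otimes> v \<in> H" using u H_subset by (auto simp: m_assoc[symmetric])
    next
      assume "inv u \<otimes> v \<in> H"
      moreover have "u \<otimes> (inv u \<otimes> v) = v" using u v by (simp add: m_assoc[symmetric])
      ultimately show "\<exists>h\<in>H. u \<otimes> h = v" by blast
    qed
    then show ?thesis using coset_eq_iff[OF u v] by blast
  qed
  have "(a, b) \<in> W" using a b ne notH by (auto simp: W_def topspace_eq_carrier)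
  then obtain U V where U: "openin T U" "a \<in> U" and V: "openin T V" "b \<in> V" and UV: "U \<times> V \<subseteq> W"
    using W unfolding openin_prod_topology_alt by blast
  have "disjnt ((\<lambda>g. g <# H) ` U) ((\<lambda>g. g <# H) ` V)"
  proof -
    have "u <# H \<noteq> v <# H" if "u \<in> U" "v \<in> V" for u v
      using that UV notH[of u v] by (auto simp: W_def topspace_eq_carrier)
    then show ?thesis by (auto simp: disjnt_def)
  qed
  then show "\<exists>U V. openin X U \<and> openin X V \<and> x \<in> U \<and> y \<in> V \<and> disjnt U V"
    using open_map_coset[OF U(1)] open_map_coset[OF V(1)] U(2) V(2) a b by blast
qed

lemma continuous_translate:
  assumes s: "s \<in> carrier G"
  shows "continuous_map X X (\<lambda>x. s <# x)"
proof (rule continuous_compose_quotient_map[OF quotient_map_coset_topology])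
  have "continuous_map T (prod_topology T T) (\<lambda>g. (s, g))"
    using s by (intro continuous_map_pairedI) (auto simp: topspace_eq_carrier)
  then have "continuous_map T T ((\<lambda>(x, y). x \<otimes> y) \<circ> (\<lambda>g. (s, g)))"
    using continuous_mult by (rule continuous_map_compose)
  then have "continuous_map T X ((\<lambda>g. g <# H) \<circ> (\<lambda>g. s \<otimes> g))"
    by (intro continuous_map_compose[OF _ quotient_imp_continuous_map[OF quotient_map_coset_topology]])
       (simp add: o_def)
  then show "continuous_map T X ((\<lambda>x. s <# x) \<circ> (\<lambda>g. g <# H))"
    by (rule continuous_map_eq) (simp add: translate_coset s topspace_eq_carrier)
qed

lemma translate_in: "s \<in> carrier G \<Longrightarrow> x \<in> lcosets H \<Longrightarrow> s <# x \<in> lcosets H"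
  by (erule coset_cases) (simp add: translate_coset coset_in)

lemma translate_inverse:
  assumes "s \<in> carrier G" "x \<in> lcosets H"
  shows "inv s <# (s <# x) = x" and "s <# (inv s <# x) = x"
  using assms by (auto elim!: coset_cases simp: translate_coset m_assoc[symmetric])

lemma coset_translate_image:
  assumes s: "s \<in> carrier G" and E: "E \<subseteq> lcosets H"
  shows "coset_translate G H s E = (\<lambda>x. s <# x) ` E"
proof
  show "coset_translate G H s E \<subseteq> (\<lambda>x. s <# x) ` E"
  proof
    fix y assume "y \<in> coset_translate G H s E"
    then obtain a where "a \<in> carrier G" "a <# H \<in> E" "y = (s \<otimes> a) <# H"
      unfolding coset_translate_def by blast
    then show "y \<in> (\<lambda>x. s <# x) ` E"
      using translate_coset[OF s, of a] by (metis image_eqI)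
  qed
  show "(\<lambda>x. s <# x) ` E \<subseteq> coset_translate G H s E"
  proof
    fix y assume "y \<in> (\<lambda>x. s <# x) ` E"
    then obtain x where x: "x \<in> E" "y = s <# x" by blast
    then obtain a where "a \<in> carrier G" "x = a <# H" using E coset_cases by blast
    then show "y \<in> coset_translate G H s E"
      using x translate_coset[OF s, of a] unfolding coset_translate_def by blast
  qed
qed

lemma coset_translate_vimage:
  assumes s: "s \<in> carrier G" and E: "E \<subseteq> lcosets H"
  shows "coset_translate G H s E = (\<lambda>x. inv s <# x) -` E \<inter> lcosets H"
  unfolding coset_translate_image[OF assms]
proof
  show "(\<lambda>x. s <# x) ` E \<subseteq> (\<lambda>x. inv s <# x) -` E \<inter> lcosets H"
  proof
    fix y assume "y \<in> (\<lambda>x. s <# x) ` E"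
    then obtain x where x: "x \<in> E" "y = s <# x" by blast
    then have "x \<in> lcosets H" using E by blast
    then show "y \<in> (\<lambda>x. inv s <# x) -` E \<inter> lcosets H"
      using x translate_inverse(1)[OF s, of x] translate_in[OF s, of x] by simp
  qed
  show "(\<lambda>x. inv s <# x) -` E \<inter> lcosets H \<subseteq> (\<lambda>x. s <# x) ` E"
  proof
    fix y assume "y \<in> (\<lambda>x. inv s <# x) -` E \<inter> lcosets H"
    then have "inv s <# y \<in> E" and "s <# (inv s <# y) = y"
      using translate_inverse(2)[OF s, of y] by auto
    then show "y \<in> (\<lambda>x. s <# x) ` E" by (metis image_eqI)
  qed
qed

end

locale relatively_invariant_space = homogeneous_space G T H
  for G :: "('g, 'm) monoid_scheme" (structure) and T :: "'g topology" and H :: "'g set" +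
  fixes \<rho> :: "'g \<Rightarrow> real" and \<mu> :: "'g set measure"
  assumes relatively_invariant: "relatively_invariant_measure G T H \<rho> \<mu>"
begin

lemma space_\<mu>: "space \<mu> = lcosets H"
  and sets_\<mu>: "sets \<mu> = sigma_sets (lcosets H) {U. openin X U}"
  using relatively_invariant topspace_X
  by (auto simp: relatively_invariant_measure_def radon_measure_def)

lemma \<rho>_pos: "g \<in> carrier G \<Longrightarrow> 0 < \<rho> g"
  and \<rho>_coset: "g \<in> carrier G \<Longrightarrow> h \<in> H \<Longrightarrow> \<rho> (g \<otimes> h) = \<rho> g"
  and \<rho>_mult: "s \<in> carrier G \<Longrightarrow> a \<in> carrier G \<Longrightarrow> \<rho> (s \<otimes> a) * \<rho> \<one> = \<rho> s * \<rho> a"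
  and \<rho>_continuous: "continuous_map T euclideanreal \<rho>"
  and \<mu>_translate: "s \<in> carrier G \<Longrightarrow> E \<in> sets \<mu> \<Longrightarrow>
    emeasure \<mu> (coset_translate G H s E) = ennreal (\<rho> s / \<rho> \<one>) * emeasure \<mu> E"
  using relatively_invariant by (auto simp: relatively_invariant_measure_def rho_function_def)

lemma open_measurable: "openin X U \<Longrightarrow> U \<in> sets \<mu>"
  unfolding sets_\<mu> by (rule sigma_sets.Basic) simp

lemma compact_measurable:
  assumes "compactin X K" shows "K \<in> sets \<mu>"
proof -
  have "closedin X K" using compactin_imp_closedin[OF Hausdorff_X assms] .
  then have "openin X (topspace X - K)" and sub: "K \<subseteq> topspace X"
    by (auto simp: closedin_def)
  then have "space \<mu> - (topspace X - K) \<in> sets \<mu>"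
    by (intro sets.compl_sets open_measurable)
  moreover have "space \<mu> - (topspace X - K) = K"
    using sub by (auto simp: space_\<mu> topspace_X)
  ultimately show ?thesis by simp
qed

lemma continuous_measurable:
  fixes f :: "'g set \<Rightarrow> 'b::topological_space"
  assumes "continuous_map X euclidean f" shows "f \<in> borel_measurable \<mu>"
proof (rule borel_measurableI)
  fix S :: "'b set" assume "open S"
  then have "openin X {x \<in> topspace X. f x \<in> S}"
    using openin_continuous_map_preimage[OF assms] by simp
  moreover have "{x \<in> topspace X. f x \<in> S} = f -` S \<inter> space \<mu>"
    by (auto simp: topspace_X space_\<mu>)
  ultimately show "f -` S \<inter> space \<mu> \<in> sets \<mu>" using open_measurable by metis
qed

lemma translate_measurable:
  assumes s: "s \<in> carrier G" shows "(\<lambda>x. s <# x) \<in> \<mu> \<rightarrow>\<^sub>M \<mu>"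
proof (rule measurable_sigma_sets[OF sets_\<mu>])
  show "{U. openin X U} \<subseteq> Pow (lcosets H)"
    using openin_subset topspace_X by blast
  show "(\<lambda>x. s <# x) \<in> space \<mu> \<rightarrow> lcosets H"
    using translate_in[OF s] by (simp add: space_\<mu>)
  fix U assume "U \<in> {U. openin X U}"
  then have "openin X {x \<in> topspace X. s <# x \<in> U}"
    using openin_continuous_map_preimage[OF continuous_translate[OF s]] by simp
  moreover have "{x \<in> topspace X. s <# x \<in> U} = (\<lambda>x. s <# x) -` U \<inter> space \<mu>"
    by (auto simp: topspace_X space_\<mu>)
  ultimately show "(\<lambda>x. s <# x) -` U \<inter> space \<mu> \<in> sets \<mu>" using open_measurable by metis
qed

definition weight :: "'g set \<Rightarrow> real"
  where "weight x = \<rho> \<one> / coset_value \<rho> x"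

lemma weight_coset: "g \<in> carrier G \<Longrightarrow> weight (g <# H) = \<rho> \<one> / \<rho> g"
  by (simp add: weight_def coset_value_l_coset[OF subgroup_H] \<rho>_coset)

lemma weight_pos: "x \<in> lcosets H \<Longrightarrow> 0 < weight x"
  by (erule coset_cases) (simp add: weight_coset \<rho>_pos)

lemma weight_measurable [measurable]: "weight \<in> borel_measurable \<mu>"
proof (rule continuous_measurable)
  show "continuous_map X euclidean weight"
  proof (rule continuous_compose_quotient_map[OF quotient_map_coset_topology])
    have "continuous_map T euclideanreal (\<lambda>g. \<rho> \<one> / \<rho> g)"
      using \<rho>_continuous \<rho>_pos
      by (intro continuous_map_real_divide continuous_map_const[THEN iffD2])
         (force simp: topspace_eq_carrier)+
    then show "continuous_map T euclideanreal (weight \<circ> (\<lambda>g. g <# H))"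
      by (rule continuous_map_eq) (simp add: weight_coset topspace_eq_carrier)
  qed
qed

lemma weight_translate:
  assumes "s \<in> carrier G" "x \<in> lcosets H"
  shows "weight x = \<rho> s / \<rho> \<one> * weight (s <# x)"
proof -
  obtain a where a: "a \<in> carrier G" "x = a <# H" using assms(2) by (rule coset_cases)
  have "\<rho> (s \<otimes> a) = \<rho> s * \<rho> a / \<rho> \<one>"
    using \<rho>_mult[OF assms(1) a(1)] \<rho>_pos[OF one_closed] by (simp add: field_simps)
  then show ?thesis
    using a assms(1) \<rho>_pos[OF assms(1)] \<rho>_pos[OF a(1)] \<rho>_pos[OF one_closed]
    by (simp add: translate_coset weight_coset)
qed

text \<open>Dividing by \<open>\<rho>\<close> compensates the factor by which a translation scales \<open>\<mu>\<close>.\<close>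

definition invariant_measure :: "'g set measure"
  where "invariant_measure = density \<mu> (\<lambda>x. ennreal (weight x))"

lemma space_invariant_measure [simp]: "space invariant_measure = lcosets H"
  and sets_invariant_measure [simp, measurable_cong]: "sets invariant_measure = sets \<mu>"
  by (simp_all add: invariant_measure_def space_\<mu>)

lemma nn_integral_translate:
  assumes s: "s \<in> carrier G" and f: "f \<in> borel_measurable \<mu>"
  shows "(\<integral>\<^sup>+x. f (s <# x) \<partial>\<mu>) = ennreal (\<rho> (inv s) / \<rho> \<one>) * (\<integral>\<^sup>+x. f x \<partial>\<mu>)"
proof -
  let ?k = "ennreal (\<rho> (inv s) / \<rho> \<one>)"
  have "distr \<mu> \<mu> (\<lambda>x. s <# x) = density \<mu> (\<lambda>_. ?k)"
  proof (rule measure_eqI)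
    fix E assume "E \<in> sets (distr \<mu> \<mu> (\<lambda>x. s <# x))"
    then have E: "E \<in> sets \<mu>" by simp
    then have sub: "E \<subseteq> lcosets H" using sets.sets_into_space space_\<mu> by blast
    have "emeasure (distr \<mu> \<mu> (\<lambda>x. s <# x)) E = emeasure \<mu> ((\<lambda>x. s <# x) -` E \<inter> lcosets H)"
      using emeasure_distr[OF translate_measurable[OF s] E] by (simp add: space_\<mu>)
    also have "(\<lambda>x. s <# x) -` E \<inter> lcosets H = coset_translate G H (inv s) E"
      using coset_translate_vimage[of "inv s" E] s sub by simp
    also have "emeasure \<mu> \<dots> = ?k * emeasure \<mu> E"
      using s E by (intro \<mu>_translate) auto
    also have "\<dots> = emeasure (density \<mu> (\<lambda>_. ?k)) E"
      using E by (simp add: emeasure_density_const)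
    finally show "emeasure (distr \<mu> \<mu> (\<lambda>x. s <# x)) E = emeasure (density \<mu> (\<lambda>_. ?k)) E" .
  qed simp
  then have "(\<integral>\<^sup>+x. f (s <# x) \<partial>\<mu>) = (\<integral>\<^sup>+x. f x \<partial>density \<mu> (\<lambda>_. ?k))"
    using nn_integral_distr[OF translate_measurable[OF s], of f] f by simp
  also have "\<dots> = ?k * (\<integral>\<^sup>+x. f x \<partial>\<mu>)"
    using f by (simp add: nn_integral_density nn_integral_cmult)
  finally show ?thesis .
qed

lemma invariant_measure_translate:
  assumes s: "s \<in> carrier G"
  shows "distr invariant_measure invariant_measure (\<lambda>x. s <# x) = invariant_measure"
proof (rule measure_eqI)
  fix E assume "E \<in> sets (distr invariant_measure invariant_measure (\<lambda>x. s <# x))"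
  then have E [measurable]: "E \<in> sets \<mu>" by simp
  have \<tau> [measurable]: "(\<lambda>x. s <# x) \<in> \<mu> \<rightarrow>\<^sub>M \<mu>" by (rule translate_measurable[OF s])
  then have \<tau>': "(\<lambda>x. s <# x) \<in> invariant_measure \<rightarrow>\<^sub>M invariant_measure"
    by (simp cong: measurable_cong_sets)
  have E': "(\<lambda>x. s <# x) -` E \<inter> space \<mu> \<in> sets \<mu>" by (rule measurable_sets[OF \<tau> E])
  have "emeasure (distr invariant_measure invariant_measure (\<lambda>x. s <# x)) E
      = emeasure invariant_measure ((\<lambda>x. s <# x) -` E \<inter> space \<mu>)"
    using emeasure_distr[OF \<tau>'] E by (simp add: space_\<mu>)
  also have "\<dots> = (\<integral>\<^sup>+x. ennreal (weight x) * indicator ((\<lambda>x. s <# x) -` E \<inter> space \<mu>) x \<partial>\<mu>)"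
    unfolding invariant_measure_def using E' by (intro emeasure_density) measurable
  also have "\<dots> = (\<integral>\<^sup>+x. ennreal (\<rho> s / \<rho> \<one>) * (ennreal (weight (s <# x)) * indicator E (s <# x)) \<partial>\<mu>)"
  proof (rule nn_integral_cong)
    fix x assume "x \<in> space \<mu>"
    then have x: "x \<in> lcosets H" by (simp add: space_\<mu>)
    have "ennreal (weight x) = ennreal (\<rho> s / \<rho> \<one>) * ennreal (weight (s <# x))"
      unfolding weight_translate[OF s x]
      using \<rho>_pos[OF s] \<rho>_pos[OF one_closed] weight_pos[OF translate_in[OF s x]]
      by (intro ennreal_mult) auto
    then show "ennreal (weight x) * indicator ((\<lambda>x. s <# x) -` E \<inter> space \<mu>) x
        = ennreal (\<rho> s / \<rho> \<one>) * (ennreal (weight (s <# x)) * indicator E (s <# x))"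
      using \<open>x \<in> space \<mu>\<close> by (simp add: mult.assoc split: split_indicator)
  qed
  also have "\<dots> = ennreal (\<rho> s / \<rho> \<one>) * (\<integral>\<^sup>+x. ennreal (weight (s <# x)) * indicator E (s <# x) \<partial>\<mu>)"
    by (rule nn_integral_cmult) measurable
  also have "\<dots> = ennreal (\<rho> s / \<rho> \<one>) * (ennreal (\<rho> (inv s) / \<rho> \<one>) * (\<integral>\<^sup>+x. ennreal (weight x) * indicator E x \<partial>\<mu>))"
    by (subst nn_integral_translate[OF s, of "\<lambda>x. ennreal (weight x) * indicator E x"]) simp_all
  also have "\<dots> = ennreal (\<rho> s / \<rho> \<one> * (\<rho> (inv s) / \<rho> \<one>)) * (\<integral>\<^sup>+x. ennreal (weight x) * indicator E x \<partial>\<mu>)"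
    using \<rho>_pos[OF s] \<rho>_pos[OF one_closed] \<rho>_pos[OF inv_closed[OF s]]
    by (subst ennreal_mult) (simp_all add: mult.assoc)
  also have "\<rho> s / \<rho> \<one> * (\<rho> (inv s) / \<rho> \<one>) = 1"
    using \<rho>_mult[OF s inv_closed[OF s]] \<rho>_pos[OF one_closed] \<rho>_pos[OF s]
      \<rho>_pos[OF inv_closed[OF s]] s
    by (simp add: field_simps)
  also have "ennreal 1 * (\<integral>\<^sup>+x. ennreal (weight x) * indicator E x \<partial>\<mu>) = emeasure invariant_measure E"
    unfolding invariant_measure_def by (simp add: emeasure_density)
  finally show "emeasure (distr invariant_measure invariant_measure (\<lambda>x. s <# x)) E
      = emeasure invariant_measure E" .
qed simp

lemma irreducible_covariant_familyI:
  fixes \<pi> :: "'g set \<Rightarrow> 'h::complex_hilbert_space \<Rightarrow> 'h"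
  assumes rep: "unitary_rep G T H \<pi>" and irr: "irreducible_rep G H \<pi>"
  shows "irreducible_covariant_family invariant_measure \<pi>"
proof
  show "unitary_operator (\<pi> x)" if "x \<in> space invariant_measure" for x
    using that rep by (simp add: unitary_rep_def)
  show "(\<lambda>x. cinner \<eta> (\<pi> x \<xi>)) \<in> borel_measurable invariant_measure" for \<eta> \<xi>
  proof -
    have "(\<lambda>x. cinner (\<pi> x \<xi>) \<eta>) \<in> borel_measurable \<mu>"
      using rep unfolding unitary_rep_def by (intro continuous_measurable) blast
    moreover have "cnj \<in> borel_measurable borel"
      by (intro borel_measurable_continuous_onI continuous_intros)
    ultimately have "(\<lambda>x. cnj (cinner (\<pi> x \<xi>) \<eta>)) \<in> borel_measurable \<mu>"
      by (rule measurable_compose)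
    then show ?thesis
      unfolding cinner_commute[of \<eta>] by (simp cong: measurable_cong_sets)
  qed
  show "irreducible_family (\<pi> ` space invariant_measure)"
    using irr unfolding irreducible_family_def irreducible_rep_def by simp
  fix x assume "x \<in> space invariant_measure"
  then obtain s where s: "s \<in> carrier G" "x = s <# H" by (auto elim: coset_cases)
  show "\<exists>\<tau>\<in>invariant_measure \<rightarrow>\<^sub>M invariant_measure.
      distr invariant_measure invariant_measure \<tau> = invariant_measure \<and>
      (\<forall>y\<in>space invariant_measure. \<forall>\<xi>. \<pi> (\<tau> y) \<xi> = \<pi> x (\<pi> y \<xi>))"
  proof (intro bexI[of _ "\<lambda>y. s <# y"] conjI ballI allI)
    show "distr invariant_measure invariant_measure (\<lambda>y. s <# y) = invariant_measure"
      by (rule invariant_measure_translate[OF s(1)])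
    show "(\<lambda>y. s <# y) \<in> invariant_measure \<rightarrow>\<^sub>M invariant_measure"
      using translate_measurable[OF s(1)] by (simp cong: measurable_cong_sets)
    fix y \<xi> assume "y \<in> space invariant_measure"
    then obtain k where "k \<in> carrier G" "y = k <# H" by (auto elim: coset_cases)
    then show "\<pi> (s <# y) \<xi> = \<pi> x (\<pi> y \<xi>)"
      using rep s by (simp add: unitary_rep_def translate_coset)
  qed
qed

text \<open>\<open>\<sigma>\<close>-compactness yields an increasing sequence of compact sets that exhausts the space, and
  dominated convergence applies to their complements.\<close>

lemma tail_small:
  fixes f :: "'g set \<Rightarrow> real"
  assumes sc: "sigma_compact_space X" and f: "integrable invariant_measure f" "\<And>x. 0 \<le> f x" and e: "0 < e"
  shows "\<exists>K. compactin X K \<and> (LINT x:lcosets H - K|invariant_measure. f x) < e"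
proof -
  from sc obtain \<K> where "countable \<K> \<and> (\<forall>K\<in>\<K>. compactin X K) \<and> \<Union>\<K> = lcosets H"
    unfolding sigma_compact_space_def topspace_X by (rule exE)
  then have \<K>: "countable \<K>" "\<And>K. K \<in> \<K> \<Longrightarrow> compactin X K" "\<Union>\<K> = lcosets H"
    by simp_all
  \<comment> \<open>inserting the empty set makes the enumeration total even if the cover is empty\<close>
  define C where "C = from_nat_into (insert {} \<K>)"
  have C: "compactin X (C n)" for n
  proof -
    have "C n \<in> insert {} \<K>" unfolding C_def by (rule from_nat_into) simp
    then show ?thesis using \<K>(2)[of "C n"] compactin_empty[of X] by (elim insertE) simp_all
  qed
  have cover: "\<exists>n. x \<in> C n" if "x \<in> lcosets H" for x
  proof -
    have "x \<in> \<Union>\<K>" using that by (simp only: \<K>(3))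
    then obtain K where "K \<in> \<K>" "x \<in> K" by (rule UnionE)
    then have "\<exists>n. C n = K"
      unfolding C_def using \<K>(1) by (intro from_nat_into_surj) simp_all
    with \<open>x \<in> K\<close> show ?thesis by metis
  qed
  define D where "D n = \<Union> (C ` {..n})" for n
  have D: "compactin X (D n)" for n
    unfolding D_def
  proof (rule compactin_Union)
    show "finite (C ` {..n})" by simp
    show "compactin X K" if "K \<in> C ` {..n}" for K using that C by blast
  qed
  have lim: "(\<lambda>n. LINT x|invariant_measure. indicator (lcosets H - D n) x *\<^sub>R f x)
      \<longlonglongrightarrow> (LINT x|invariant_measure. 0)"
  proof (rule integral_dominated_convergence[where w = f])
    show "(\<lambda>x. 0::real) \<in> borel_measurable invariant_measure" by (rule borel_measurable_const)
    show "(\<lambda>x. indicator (lcosets H - D n) x *\<^sub>R f x) \<in> borel_measurable invariant_measure" for n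
    proof -
      have "lcosets H - D n \<in> sets invariant_measure"
        using sets.compl_sets[OF compact_measurable[OF D, of n]] by (simp add: space_\<mu>)
      then have "integrable invariant_measure (\<lambda>x. indicator (lcosets H - D n) x *\<^sub>R f x)"
        using f(1) by (rule integrable_mult_indicator)
      then show ?thesis by (rule borel_measurable_integrable)
    qed
    show "AE x in invariant_measure. norm (indicator (lcosets H - D n) x *\<^sub>R f x) \<le> f x" for n
      using f(2) by (auto split: split_indicator)
    show "AE x in invariant_measure. (\<lambda>n. indicator (lcosets H - D n) x *\<^sub>R f x) \<longlonglongrightarrow> 0"
    proof (rule AE_I2)
      fix x assume "x \<in> space invariant_measure"
      then obtain m where m: "x \<in> C m" using cover[of x] by auto
      have "\<forall>\<^sub>F n in sequentially. indicator (lcosets H - D n) x *\<^sub>R f x = 0"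
        unfolding eventually_sequentially
      proof (intro exI[of _ m] allI impI)
        fix n assume "m \<le> n"
        then have "x \<in> D n" using m by (auto simp: D_def)
        then show "indicator (lcosets H - D n) x *\<^sub>R f x = 0" by simp
      qed
      then show "(\<lambda>n. indicator (lcosets H - D n) x *\<^sub>R f x) \<longlonglongrightarrow> 0"
        by (rule tendsto_eventually)
    qed
  qed (rule f(1))
  have "\<forall>\<^sub>F n in sequentially.
      (LINT x|invariant_measure. indicator (lcosets H - D n) x *\<^sub>R f x) < e"
    by (rule order_tendstoD(2)[OF lim]) (simp add: e)
  then obtain n where "(LINT x|invariant_measure. indicator (lcosets H - D n) x *\<^sub>R f x) < e"
    unfolding eventually_sequentially by blast
  then show ?thesis
    unfolding set_lebesgue_integral_def by (intro exI[of _ "D n"] conjI D)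
qed

text \<open>
  The compact set is chosen for \<open>\<eta>\<close> alone. Substituting \<open>x \<mapsto> s x\<close> shows that the coefficients of
  \<open>\<pi> (s H) \<eta>\<close> outside \<open>s K'\<close> have the same square integral as those of \<open>\<eta>\<close> outside \<open>K'\<close>, and enlarging
  \<open>K\<close> to \<open>K'\<close> only decreases it. Hence one \<open>K\<close> serves every \<open>s\<close>.
\<close>

theorem homogeneous_approximation:
  fixes \<pi> :: "'g set \<Rightarrow> 'h::complex_hilbert_space \<Rightarrow> 'h"
  assumes sc: "sigma_compact_space X" and rep: "unitary_rep G T H \<pi>"
    and irr: "irreducible_rep G H \<pi>" and pair: "admissible_pair G \<rho> \<mu> \<pi> \<xi>\<^sub>1 \<xi>\<^sub>2"
  shows "homogeneous_approximation_property G T H \<rho> \<mu> \<pi> \<xi>\<^sub>1 \<xi>\<^sub>2"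
proof -
  let ?\<nu> = invariant_measure
  interpret irreducible_covariant_family ?\<nu> \<pi>
    using rep irr by (rule irreducible_covariant_familyI)
  have w: "AE x in \<mu>. 0 \<le> weight x"
    by (rule AE_I2) (simp add: space_\<mu> weight_pos less_imp_le)
  have coeff [measurable]: "(\<lambda>x. cinner \<eta> (\<pi> x \<xi>)) \<in> borel_measurable \<mu>" for \<eta> \<xi>
    using measurable_coefficient[of \<eta> \<xi>] by (simp cong: measurable_cong_sets)
  have wt: "wavelet_transform G \<rho> \<pi> \<xi> \<eta> x = complex_of_real (sqrt (weight x)) * cinner \<eta> (\<pi> x \<xi>)" for \<xi> \<eta> x
    by (simp add: wavelet_transform_def weight_def)
  have sqrt2: "complex_of_real (sqrt (weight x)) * complex_of_real (sqrt (weight x)) = complex_of_real (weight x)"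
    if "x \<in> space \<mu>" for x
    using weight_pos[of x] that by (simp add: space_\<mu> flip: of_real_mult)
  have adm: "admissible \<xi>" if "admissible_wavelet G \<rho> \<mu> \<pi> \<xi>" for \<xi>
  proof (rule admissibleI)
    have "wavelet_constant G \<rho> \<mu> \<pi> \<xi> = (\<integral>\<^sup>+x. ennreal (weight x) * ennreal ((cmod (cinner \<xi> (\<pi> x \<xi>)))\<^sup>2) \<partial>\<mu>)"
      unfolding wavelet_constant_def weight_def[symmetric]
      by (intro nn_integral_cong ennreal_mult) (simp_all add: space_\<mu> weight_pos less_imp_le)
    also have "\<dots> = (\<integral>\<^sup>+x. ennreal ((cmod (cinner \<xi> (\<pi> x \<xi>)))\<^sup>2) \<partial>?\<nu>)"
      unfolding invariant_measure_def by (intro nn_integral_density[symmetric]) measurable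
    also have "\<dots> = coefficient_form \<xi> \<xi>" by (rule coefficient_form_def[symmetric])
    finally have eq: "wavelet_constant G \<rho> \<mu> \<pi> \<xi> = coefficient_form \<xi> \<xi>" .
    show "coefficient_form \<xi> \<xi> < \<infinity>" using that eq by (simp add: admissible_wavelet_def)
    show "\<xi> \<noteq> 0"
    proof
      assume "\<xi> = 0"
      then have "coefficient_form \<xi> \<xi> = 0" by (simp add: coefficient_form_def)
      then show False using that eq by (simp add: admissible_wavelet_def)
    qed
  qed
  have a1: "admissible \<xi>\<^sub>1" and a2: "admissible \<xi>\<^sub>2" and ne: "cinner \<xi>\<^sub>1 \<xi>\<^sub>2 \<noteq> 0"
    and C0: "pair_constant G \<rho> \<mu> \<pi> \<xi>\<^sub>1 \<xi>\<^sub>2 \<noteq> 0"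
    using pair adm by (auto simp: admissible_pair_def)
  obtain c where c: "\<And>\<eta> \<zeta>. (LINT x|?\<nu>. cinner \<eta> (\<pi> x \<xi>\<^sub>1) * cnj (cinner \<zeta> (\<pi> x \<xi>\<^sub>2))) = c * cinner \<eta> \<zeta>"
    using orthogonality_relations[OF a1 a2] by blast
  obtain c2 where c2: "c2 \<ge> 0" "\<And>\<zeta>. (LINT x|?\<nu>. (cmod (cinner \<zeta> (\<pi> x \<xi>\<^sub>2)))\<^sup>2) = c2 * (norm \<zeta>)\<^sup>2"
    using admissible_integral[OF a2] by blast
  have [measurable]: "cnj \<in> borel_measurable borel"
    by (intro borel_measurable_continuous_onI continuous_intros)
  have C: "pair_constant G \<rho> \<mu> \<pi> \<xi>\<^sub>1 \<xi>\<^sub>2 = c"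
  proof -
    have "(LINT x|\<mu>. wavelet_transform G \<rho> \<pi> \<xi>\<^sub>1 \<xi>\<^sub>1 x * cnj (wavelet_transform G \<rho> \<pi> \<xi>\<^sub>2 \<xi>\<^sub>2 x))
        = (LINT x|\<mu>. weight x *\<^sub>R (cinner \<xi>\<^sub>1 (\<pi> x \<xi>\<^sub>1) * cnj (cinner \<xi>\<^sub>2 (\<pi> x \<xi>\<^sub>2))))"
      by (rule Bochner_Integration.integral_cong) (auto simp: wt scaleR_conv_of_real simp flip: sqrt2)
    also have "\<dots> = c * cinner \<xi>\<^sub>1 \<xi>\<^sub>2"
      unfolding c[symmetric] invariant_measure_def
      by (rule integral_density[symmetric]) (use w in measurable)
    finally show ?thesis using ne by (simp add: pair_constant_def)
  qed
  have c0: "c \<noteq> 0" using C0 C by simp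
  show ?thesis
    unfolding homogeneous_approximation_property_def C
  proof (intro allI impI)
    fix \<eta> :: 'h and \<epsilon> :: real assume \<epsilon>: "\<epsilon> > 0"
    let ?q = "\<lambda>\<eta> x. (cmod (cinner \<eta> (\<pi> x \<xi>\<^sub>1)))\<^sup>2"
    have iq: "integrable ?\<nu> (?q \<eta>)" for \<eta>
      using admissible_square_integrable[OF a1] by (simp add: square_integrable_def)
    \<comment> \<open>The denominator is \<open>c2 + 1\<close> because \<open>c2\<close> may vanish when only \<open>0 \<le> c2\<close> is known.\<close>
    define \<delta> where "\<delta> = (cmod c * \<epsilon>)\<^sup>2 / (c2 + 1)"
    have \<delta>: "0 < \<delta>" "c2 * \<delta> \<le> (cmod c * \<epsilon>)\<^sup>2"
      using c0 \<epsilon> c2(1) by (simp_all add: \<delta>_def field_simps add_nonneg_pos)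
    obtain K where K: "compactin X K" and tail: "(LINT x:lcosets H - K|?\<nu>. ?q \<eta> x) < \<delta>"
      using tail_small[OF sc iq _ \<delta>(1), of \<eta>] by auto
    show "\<exists>K. compactin X K \<and> (\<forall>K'. compactin X K' \<longrightarrow> K \<subseteq> K' \<longrightarrow>
      (\<forall>s\<in>carrier G. \<exists>v.
          has_weak_integral \<mu> (coset_translate G H s K')
            (\<lambda>x. (complex_of_real (sqrt (\<rho> \<one> / coset_value \<rho> x)) *
                  wavelet_transform G \<rho> \<pi> \<xi>\<^sub>1 (\<pi> (s <# H) \<eta>) x) *\<^sub>C \<pi> x \<xi>\<^sub>2) v \<and>
          norm (\<pi> (s <# H) \<eta> - inverse c *\<^sub>C v) \<le> \<epsilon>))"
    proof (intro exI[of _ K] conjI K allI impI ballI)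
      fix K' s assume K': "compactin X K'" "K \<subseteq> K'" and s: "s \<in> carrier G"
      have K'm: "K' \<in> sets \<mu>" by (rule compact_measurable[OF K'(1)])
      have K'sub: "K' \<subseteq> lcosets H" using K'm sets.sets_into_space space_\<mu> by blast
      let ?A = "coset_translate G H s K'" and ?\<eta> = "\<pi> (s <# H) \<eta>"
      have A: "?A \<in> sets \<mu>"
        using measurable_sets[OF translate_measurable K'm, of "inv s"] s
        by (simp add: coset_translate_vimage[OF s K'sub] space_\<mu>)
      obtain v where v: "has_weak_integral ?\<nu> ?A (\<lambda>x. cinner ?\<eta> (\<pi> x \<xi>\<^sub>1) *\<^sub>C \<pi> x \<xi>\<^sub>2) v"
        using partial_integral_exists[OF a1 a2, of ?A ?\<eta>] A by auto
      \<comment> \<open>The integrand of the property carries the square root of the weight twice, which turns \<open>\<mu>\<close>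
        into the invariant measure.\<close>
      have weak: "has_weak_integral \<mu> ?A
          (\<lambda>x. (complex_of_real (sqrt (\<rho> \<one> / coset_value \<rho> x)) *
                wavelet_transform G \<rho> \<pi> \<xi>\<^sub>1 ?\<eta> x) *\<^sub>C \<pi> x \<xi>\<^sub>2) v"
        unfolding has_weak_integral_def
      proof
        fix \<zeta>
        let ?F = "\<lambda>x. indicator ?A x *\<^sub>R cinner (cinner ?\<eta> (\<pi> x \<xi>\<^sub>1) *\<^sub>C \<pi> x \<xi>\<^sub>2) \<zeta>"
        let ?E = "\<lambda>x. indicator ?A x *\<^sub>R cinner ((complex_of_real (sqrt (\<rho> \<one> / coset_value \<rho> x)) *
                wavelet_transform G \<rho> \<pi> \<xi>\<^sub>1 ?\<eta> x) *\<^sub>C \<pi> x \<xi>\<^sub>2) \<zeta>"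
        have "?F = (\<lambda>x. indicator ?A x *\<^sub>R (cinner ?\<eta> (\<pi> x \<xi>\<^sub>1) * cnj (cinner \<zeta> (\<pi> x \<xi>\<^sub>2))))"
          by (simp add: cinner_scaleC_left cinner_commute[of "\<pi> _ \<xi>\<^sub>2" \<zeta>])
        then have F: "?F \<in> borel_measurable \<mu>" using A by simp
        have E: "?E x = weight x *\<^sub>R ?F x" if "x \<in> space \<mu>" for x
          using sqrt2[OF that, symmetric]
          by (simp add: wt weight_def[symmetric] cinner_scaleC_left scaleR_conv_of_real mult_ac)
        have "integrable ?\<nu> ?F" "cinner v \<zeta> = (LINT x|?\<nu>. ?F x)"
          using v unfolding has_weak_integral_def set_integrable_def set_lebesgue_integral_def by blast+
        then have "integrable \<mu> (\<lambda>x. weight x *\<^sub>R ?F x)" "cinner v \<zeta> = (LINT x|\<mu>. weight x *\<^sub>R ?F x)"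
          unfolding invariant_measure_def
          by (simp_all only: integrable_density[OF F weight_measurable w] integral_density[OF F weight_measurable w])
        then show "set_integrable \<mu> ?A (\<lambda>x. cinner ((complex_of_real (sqrt (\<rho> \<one> / coset_value \<rho> x)) *
                wavelet_transform G \<rho> \<pi> \<xi>\<^sub>1 ?\<eta> x) *\<^sub>C \<pi> x \<xi>\<^sub>2) \<zeta>) \<and>
              cinner v \<zeta> = (LINT x:?A|\<mu>. cinner ((complex_of_real (sqrt (\<rho> \<one> / coset_value \<rho> x)) *
                wavelet_transform G \<rho> \<pi> \<xi>\<^sub>1 ?\<eta> x) *\<^sub>C \<pi> x \<xi>\<^sub>2) \<zeta>)"
          unfolding set_integrable_def set_lebesgue_integral_def
          using Bochner_Integration.integrable_cong[OF refl E, of \<mu>]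
            Bochner_Integration.integral_cong[OF refl E, of \<mu>] by simp
      qed
      have unitary_s: "unitary_operator (\<pi> (s <# H))"
        using unitary coset_in[OF s] by simp
      have "(LINT x:lcosets H - ?A|?\<nu>. ?q ?\<eta> x) = (LINT x:lcosets H - K'|?\<nu>. ?q \<eta> x)"
      proof -
        have "(LINT x:lcosets H - ?A|?\<nu>. ?q ?\<eta> x)
            = (LINT x|distr ?\<nu> ?\<nu> (\<lambda>x. s <# x). indicator (lcosets H - ?A) x *\<^sub>R ?q ?\<eta> x)"
          by (simp add: invariant_measure_translate[OF s] set_lebesgue_integral_def)
        also have "\<dots> = (LINT x|?\<nu>. indicator (lcosets H - ?A) (s <# x) *\<^sub>R ?q ?\<eta> (s <# x))"
        proof (rule integral_distr)
          show "(\<lambda>x. s <# x) \<in> ?\<nu> \<rightarrow>\<^sub>M ?\<nu>"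
            using translate_measurable[OF s] by (simp cong: measurable_cong_sets)
          have "lcosets H - ?A \<in> sets \<mu>"
            using sets.compl_sets[OF A] by (simp add: space_\<mu>)
          then show "(\<lambda>x. indicator (lcosets H - ?A) x *\<^sub>R ?q ?\<eta> x) \<in> borel_measurable ?\<nu>"
            by (simp cong: measurable_cong_sets)
        qed
        also have "\<dots> = (LINT x|?\<nu>. indicator (lcosets H - K') x *\<^sub>R ?q \<eta> x)"
        proof (rule Bochner_Integration.integral_cong[OF refl])
          fix x assume "x \<in> space ?\<nu>"
          then have x: "x \<in> lcosets H" by simp
          then obtain k where k: "k \<in> carrier G" "x = k <# H" by (rule coset_cases)
          have "\<pi> (s <# x) \<xi>\<^sub>1 = \<pi> (s <# H) (\<pi> x \<xi>\<^sub>1)"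
            using rep s k by (simp add: unitary_rep_def translate_coset)
          then have "?q ?\<eta> (s <# x) = ?q \<eta> x"
            using unitary_s by (simp add: unitary_operator_def)
          moreover have "s <# x \<in> ?A \<longleftrightarrow> x \<in> K'"
            using translate_in[OF s x] translate_inverse(1)[OF s x]
            by (simp add: coset_translate_vimage[OF s K'sub])
          ultimately show "indicator (lcosets H - ?A) (s <# x) *\<^sub>R ?q ?\<eta> (s <# x)
              = indicator (lcosets H - K') x *\<^sub>R ?q \<eta> x"
            using x translate_in[OF s x] by (simp split: split_indicator)
        qed
        finally show ?thesis by (simp add: set_lebesgue_integral_def)
      qed
      also have "\<dots> \<le> (LINT x:lcosets H - K|?\<nu>. ?q \<eta> x)"
        unfolding set_lebesgue_integral_def
      proof (rule integral_mono)
        have I: "integrable ?\<nu> (\<lambda>x. indicator (lcosets H - E) x *\<^sub>R ?q \<eta> x)" if "E \<in> sets \<mu>" for E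
          using sets.compl_sets[OF that] by (intro integrable_mult_indicator iq) (simp add: space_\<mu>)
        show "integrable ?\<nu> (\<lambda>x. indicator (lcosets H - K') x *\<^sub>R ?q \<eta> x)"
          and "integrable ?\<nu> (\<lambda>x. indicator (lcosets H - K) x *\<^sub>R ?q \<eta> x)"
          by (rule I[OF K'm], rule I[OF compact_measurable[OF K]])
        show "indicator (lcosets H - K') x *\<^sub>R ?q \<eta> x \<le> indicator (lcosets H - K) x *\<^sub>R ?q \<eta> x" for x
          using K'(2) by (auto split: split_indicator)
      qed
      finally have tl: "(LINT x:lcosets H - ?A|?\<nu>. ?q ?\<eta> x) \<le> \<delta>" using tail by simp
      have "(norm (c *\<^sub>C ?\<eta> - v))\<^sup>2 \<le> c2 * (LINT x:lcosets H - ?A|?\<nu>. ?q ?\<eta> x)"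
        using partial_integral_error[OF a1 a2 _ c c2 v] A by simp
      also have "\<dots> \<le> c2 * \<delta>" using tl c2(1) by (rule mult_left_mono)
      also have "\<dots> \<le> (cmod c * \<epsilon>)\<^sup>2" by (rule \<delta>(2))
      finally have le: "norm (c *\<^sub>C ?\<eta> - v) \<le> cmod c * \<epsilon>"
        by (rule power2_le_imp_le) (use \<epsilon> in simp)
      have "?\<eta> - inverse c *\<^sub>C v = inverse c *\<^sub>C (c *\<^sub>C ?\<eta> - v)"
        using c0 by (simp add: scaleC_diff_right scaleC_scaleC)
      then have "norm (?\<eta> - inverse c *\<^sub>C v) = norm (c *\<^sub>C ?\<eta> - v) / cmod c"
        by (simp add: norm_inverse divide_inverse mult.commute)
      also have "\<dots> \<le> \<epsilon>" using le c0 by (simp add: pos_divide_le_eq mult.commute)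
      finally have "norm (?\<eta> - inverse c *\<^sub>C v) \<le> \<epsilon>" .
      with weak show "\<exists>v.
          has_weak_integral \<mu> ?A
            (\<lambda>x. (complex_of_real (sqrt (\<rho> \<one> / coset_value \<rho> x)) *
                  wavelet_transform G \<rho> \<pi> \<xi>\<^sub>1 ?\<eta> x) *\<^sub>C \<pi> x \<xi>\<^sub>2) v \<and>
          norm (?\<eta> - inverse c *\<^sub>C v) \<le> \<epsilon>" by blast
    qed
  qed
qed

end

theorem theorem3p2:
  fixes G :: "('g, 'm) monoid_scheme" and T :: "'g topology" and H :: "'g set"
    and \<rho> :: "'g \<Rightarrow> real" and \<mu> :: "'g set measure"
    and \<pi> :: "'g set \<Rightarrow> 'h::complex_hilbert_space \<Rightarrow> 'h"
    and \<xi>\<^sub>1 \<xi>\<^sub>2 :: 'h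
  assumes "locally_compact_group G T"
    and "subgroup H G" and "closedin T H"
    and "\<forall>h\<in>H. modular_function G T h =
                modular_function (G\<lparr>carrier := H\<rparr>) (subtopology T H) h"
    and "sigma_compact_space (coset_topology G T H)"
    and "relatively_invariant_measure G T H \<rho> \<mu>"
    and "unitary_rep G T H \<pi>"
    and "irreducible_rep G H \<pi>"
    and "square_integrable_rep G \<rho> \<mu> \<pi>"
    and "admissible_pair G \<rho> \<mu> \<pi> \<xi>\<^sub>1 \<xi>\<^sub>2"
  shows "homogeneous_approximation_property G T H \<rho> \<mu> \<pi> \<xi>\<^sub>1 \<xi>\<^sub>2"
proof -
  interpret relatively_invariant_space G T H \<rho> \<mu>
    using assms(1-3,6)
    by (simp add: relatively_invariant_space_def relatively_invariant_space_axioms_def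
        homogeneous_space_def homogeneous_space_axioms_def)
  show ?thesis using assms(5,7,8,10) by (rule homogeneous_approximation)
qed

end
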